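(* There are universal constants $\rho_2\simeq 0.110549$ and $\beta_2\simeq 0.091287$ such that, for any polynomial $P\in\mathbb{C}[z]$ of degree at least $2$ with simple roots $(z_j)$, writing $r_c=\min|P(\mathrm{Crit}(P))|$: (1) For every root $z_j$ of $P$, the Newton map $N_P$ converges bi-exponentially to $z_j$ on the disk $D\left(z_j,\ \rho_2 r_c/|P'(z_j)|\right)$. (2) The Newton flow $\zeta'(t)=-P(\zeta(t))/P'(\zeta(t))$ in time $$T=\log\frac{1.1}{\beta_2}+\log\frac{\max|P(\mathrm{Crit}(P))|}{\min|P(\mathrm{Crit}(P))|}$$ maps the level line $$\mathcal{L}=\{z\in\mathbb{C} : |P(z)|=1.1\max|P(\mathrm{Crit}(P))|\}$$ into the union of the quadratic basins of attraction of the roots of $P$ for the Newton map $N_P$; that is, for every solution $\zeta$ of the flow with $\zeta(0)\in\mathcal{L}$ that is defined on $[0,T]$, the point $\zeta(T)$ belongs to the quadratic basin of some root of $P$. Moreover, $\log\frac{1.1}{\beta_2}\leq 2.5$.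
   Context: $D(z,r)=\{z'\in\mathbb{C}: |z'-z|<r\}$. $\mathrm{Crit}(P)=\{z\in\mathbb{C}:P'(z)=0\}$. The Newton map of $P$ is $N_P(z)=z-P(z)/P'(z)$, and $N_P^n$ denotes its $n$-fold composition. "Universal" means independent of $P$; the symbol $\simeq$ gives the decimal value of a constant to the displayed accuracy. The iterates of $N_P$ from $z$ converge bi-exponentially to a root $z_\ast$ if they are all defined and there exist $C>0$ and $q\in(0,1)$ such that $|N_P^n(z)-z_\ast|\leq C^{-1}q^{2^n}$ for all $n\geq 0$. The quadratic basin of a root $z_\ast$ is the set of points $z$ from which the iterates of $N_P$ converge bi-exponentially to $z_\ast$. *)

theory Defs
  imports "HOL-Analysis.Analysis" "HOL-Computational_Algebra.Polynomial"
begin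

definition Crit :: "complex poly \<Rightarrow> complex set" where
  "Crit P = {z. poly (pderiv P) z = 0}"

text \<open>For \<^term>\<open>degree P \<ge> 2\<close> the set \<^term>\<open>Crit P\<close> is finite and nonempty,
  so that \<^const>\<open>Min\<close> and \<^const>\<open>Max\<close> below are a genuine minimum and maximum.\<close>

definition min_crit_value :: "complex poly \<Rightarrow> real" where
  "min_crit_value P = Min ((\<lambda>c. cmod (poly P c)) ` Crit P)"

definition max_crit_value :: "complex poly \<Rightarrow> real" where
  "max_crit_value P = Max ((\<lambda>c. cmod (poly P c)) ` Crit P)"

definition newton_map :: "complex poly \<Rightarrow> complex \<Rightarrow> complex" where
  "newton_map P z = z - poly P z / poly (pderiv P) z"

text \<open>Since \<^term>\<open>x / 0 = (0 :: complex)\<close>, \<^const>\<open>newton_map\<close> is a total function; that all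
  iterates are defined is expressed by the orbit never meeting \<^const>\<open>Crit\<close>.
  (When all roots are simple, the critical points are exactly the poles of the Newton map.)\<close>

definition newton_converges_biexp :: "complex poly \<Rightarrow> complex \<Rightarrow> complex \<Rightarrow> bool" where
  "newton_converges_biexp P r z \<longleftrightarrow>
     (\<forall>n. (newton_map P ^^ n) z \<notin> Crit P) \<and>
     (\<exists>C q :: real. C > 0 \<and> 0 < q \<and> q < 1 \<and>
        (\<forall>n. cmod ((newton_map P ^^ n) z - r) \<le> inverse C * q ^ (2 ^ n)))"

definition quadratic_basin :: "complex poly \<Rightarrow> complex \<Rightarrow> complex set" where
  "quadratic_basin P r = {z. newton_converges_biexp P r z}"

text \<open>A solution of the Newton flow has to avoid the critical points, where the vector field
  is undefined. The derivatives at the two endpoints are one-sided.\<close>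

definition newton_flow_solution :: "complex poly \<Rightarrow> real \<Rightarrow> (real \<Rightarrow> complex) \<Rightarrow> bool" where
  "newton_flow_solution P T \<zeta> \<longleftrightarrow>
     (\<forall>t\<in>{0..T}. \<zeta> t \<notin> Crit P \<and>
        (\<zeta> has_vector_derivative - (poly P (\<zeta> t) / poly (pderiv P) (\<zeta> t))) (at t within {0..T}))"

definition level_line :: "complex poly \<Rightarrow> complex set" where
  "level_line P = {z. cmod (poly P z) = 1.1 * max_crit_value P}"

definition flow_time :: "real \<Rightarrow> complex poly \<Rightarrow> real" where
  "flow_time \<beta> P = ln (1.1 / \<beta>) + ln (max_crit_value P / min_crit_value P)"

text \<open>\<open>x \<simeq> d\<close> for a decimal \<open>d\<close> with six digits after the point: \<open>x\<close> rounds to \<open>d\<close>.\<close>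

definition approx6 :: "real \<Rightarrow> real \<Rightarrow> bool" where
  "approx6 x d \<longleftrightarrow> \<bar>x - d\<bar> \<le> 1 / (2 * 10 ^ 6)"

end

theory Submission
  imports Defs "HOL-Complex_Analysis.Complex_Analysis"
    "HOL-Computational_Algebra.Fundamental_Theorem_Algebra"
begin

unbundle no fps_syntax

text \<open>
  Over the disk of radius \<open>r\<^sub>c\<close> around \<open>0\<close> the polynomial \<open>P\<close> has no critical values, so through every
  preimage of a point there passes an inverse branch of \<open>P\<close>, holomorphic on the whole disk. Rescaled to the unit disk, such a
  branch is a univalent function \<open>f\<close> with \<open>f 0 = 0\<close> and \<open>f' 0 = 1\<close>, and the Newton map becomes
  \<open>f w \<mapsto> f w - w f' w\<close>. Write \<open>f w = w / u(w)\<^sup>3\<close>; the area theorem applied to the cube-root transform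
  \<open>z / u(z\<^sup>3)\<close> of \<open>f\<close> bounds the Taylor coefficients of \<open>u\<close> by \<open>1 / \<surd>2\<close>, and
  \<open>f w - w f' w = 3 (f w)\<^sup>2 (u w)\<^sup>2 u' w\<close>. This gives \<open>|N(z) - z\<^sub>j| \<le> (6/d) |z - z\<^sub>j|\<^sup>2\<close> for
  \<open>|z - z\<^sub>j| < d/8\<close>, where \<open>d = r\<^sub>c / |P'(z\<^sub>j)|\<close>, hence bi-exponential convergence there, and \<open>1/8 > \<rho>\<^sub>2\<close>.
  The Newton flow multiplies \<open>P\<close> by \<open>e\<^sup>-\<^sup>t\<close>, so at time \<open>T\<close> it has reached \<open>|P| = \<beta>\<^sub>2 r\<^sub>c\<close>, and
  the same bounds on \<open>u\<close> place this set inside the disks of radius \<open>d/8\<close>.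
\<close>

section \<open>Area of holomorphic images\<close>

lemma measurable_vector2 [measurable]:
  "(\<lambda>(x, y). vector [x, y] :: real^2) \<in> borel_measurable (lborel \<Otimes>\<^sub>M lborel)"
  unfolding lborel_prod case_prod_unfold
  by (rule borel_measurable_euclidean_space[THEN iffD2])
     (auto simp: Basis_vec_def inner_axis vector_def forall_2 intro!: borel_measurable_continuous_onI continuous_intros)

text \<open>Change of variables for areas takes place on \<open>real^2\<close>, Tonelli on a product
  measure; identifying the two measures lets one computation use both.\<close>

lemma lborel_real2_eq_distr:
  "(lborel :: (real^2) measure) = distr (lborel \<Otimes>\<^sub>M lborel) borel (\<lambda>(x, y). vector [x, y])"
proof (rule lborel_eqI)
  fix l u :: "real^2"
  assume *: "\<And>b. b \<in> Basis \<Longrightarrow> l \<bullet> b \<le> u \<bullet> b"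
  have le: "l $ i \<le> u $ i" for i
    using *[of "axis i 1"] by (simp add: inner_axis axis_in_Basis_iff)
  have vim: "(\<lambda>(x, y). vector [x, y] :: real^2) -` box l u \<inter> space (lborel \<Otimes>\<^sub>M lborel)
     = {l$1<..<u$1} \<times> {l$2<..<u$2}"
    by (auto simp: mem_box Basis_vec_def inner_axis forall_2 space_pair_measure)
  have "emeasure (distr (lborel \<Otimes>\<^sub>M lborel) borel (\<lambda>(x, y). vector [x, y])) (box l u)
     = emeasure (lborel \<Otimes>\<^sub>M lborel) ({l$1<..<u$1} \<times> {l$2<..<u$2})"
    by (subst emeasure_distr) (auto simp: vim)
  also have "\<dots> = ennreal ((u$1 - l$1) * (u$2 - l$2))"
    using le by (subst lborel.emeasure_pair_measure_Times) (auto simp: ennreal_mult)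
  also have "(u$1 - l$1) * (u$2 - l$2) = (\<Prod>b\<in>Basis. (u - l) \<bullet> b)"
    by (simp add: Basis_vec_def inner_axis UNIV_2 axis_eq_axis)
  finally show "emeasure (distr (lborel \<Otimes>\<^sub>M lborel) borel (\<lambda>(x, y). vector [x, y])) (box l u)
     = (\<Prod>b\<in>Basis. (u - l) \<bullet> b)" .
qed simp

lemma nn_integral_real2:
  fixes f :: "real^2 \<Rightarrow> ennreal"
  assumes [measurable]: "f \<in> borel_measurable borel"
  shows "(\<integral>\<^sup>+v. f v \<partial>lborel) = (\<integral>\<^sup>+x. \<integral>\<^sup>+y. f (vector [x, y]) \<partial>lborel \<partial>lborel)"
proof -
  have "(\<integral>\<^sup>+v. f v \<partial>lborel) = (\<integral>\<^sup>+z. f (case z of (x, y) \<Rightarrow> vector [x, y]) \<partial>(lborel \<Otimes>\<^sub>M lborel))"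
    by (subst lborel_real2_eq_distr, subst nn_integral_distr) auto
  also have "\<dots> = (\<integral>\<^sup>+x. \<integral>\<^sup>+y. f (vector [x, y]) \<partial>lborel \<partial>lborel)"
    by (subst lborel.nn_integral_fst[symmetric]) auto
  finally show ?thesis .
qed

text \<open>Bessel's inequality on a circle for the two frequencies \<open>0\<close> and \<open>m\<close>.\<close>

lemma mean_square_ge:
  assumes Q: "Q holomorphic_on ball 0 1" and \<rho>: "0 < \<rho>" "\<rho> < 1" and m: "m > 0"
  obtains J where "((\<lambda>t. (cmod (Q (\<rho> * cis t)))\<^sup>2) has_integral J) {0..2*pi}"
    and "J \<ge> 2 * pi * ((cmod (Q 0))\<^sup>2 + (cmod ((deriv ^^ m) Q 0 / fact m))\<^sup>2 * \<rho> ^ (2 * m))"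
proof -
  \<comment> \<open>Cauchy's formula for higher derivatives, parametrised by the angle: Taylor
    coefficients are Fourier coefficients on the circle.\<close>
  have fourier: "((\<lambda>t. F (\<rho> * cis t) * cis (- real n * t)) has_integral 2 * pi * ((deriv ^^ n) F 0 / fact n * \<rho> ^ n)) {0..2*pi}"
    if F: "F holomorphic_on ball 0 1" for F :: "complex \<Rightarrow> complex" and n
  proof -
    have "((\<lambda>u. F u / (u - 0) ^ Suc n) has_contour_integral 2 * pi * \<i> / fact n * (deriv ^^ n) F 0) (circlepath 0 \<rho>)"
      using \<rho> by (intro Cauchy_has_contour_integral_higher_derivative_circlepath
          holomorphic_on_imp_continuous_on holomorphic_on_subset[OF F]) auto
    then have "((\<lambda>t. F (\<rho> * cis t) / (\<rho> * cis t) ^ Suc n * \<rho> * \<i> * cis t) has_integral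
        2 * pi * \<i> / fact n * (deriv ^^ n) F 0) {0..2*pi}"
      unfolding circlepath_def by (subst (asm) has_contour_integral_part_circlepath_iff) auto
    from has_integral_mult_right[OF this, of "\<rho> ^ n / \<i>"]
    have "((\<lambda>t. \<rho> ^ n / \<i> * (F (\<rho> * cis t) / (\<rho> * cis t) ^ Suc n * \<rho> * \<i> * cis t)) has_integral
        2 * pi * ((deriv ^^ n) F 0 / fact n * \<rho> ^ n)) {0..2*pi}"
      by (simp add: field_simps)
    moreover have "\<rho> ^ n / \<i> * (F (\<rho> * cis t) / (\<rho> * cis t) ^ Suc n * \<rho> * \<i> * cis t) = F (\<rho> * cis t) * cis (- real n * t)" for t
    proof -
      have "cis (- real n * t) = inverse (cis t ^ n)"
        using cis_inverse[of "real n * t"] by (simp add: Complex.DeMoivre)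
      then show ?thesis using \<rho> by (simp add: field_simps)
    qed
    ultimately show ?thesis by simp
  qed
  define a where "a = Q 0"
  define b where "b = (deriv ^^ m) Q 0 / fact m * \<rho> ^ m"
  \<comment> \<open>\<open>s\<close> is the part of \<open>Q\<close> on the circle with frequencies
    0 and \<open>m\<close>. Integrating |Q - s|^2 >= 0 gives the bound, because the cross term
    equals twice the integral of |s|^2.\<close>
  define s where "s t = a + b * cis (real m * t)" for t
  have cnj_s: "cnj (s t) = cnj a + cnj b * cis (- real m * t)" for t
    by (simp add: s_def cis_cnj)
  have i1: "((\<lambda>t. Q (\<rho> * cis t)) has_integral 2 * pi * a) {0..2*pi}"
    using fourier[OF Q, of 0] by (simp add: a_def)
  have i2: "((\<lambda>t. Q (\<rho> * cis t) * cis (- real m * t)) has_integral 2 * pi * b) {0..2*pi}"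
    using fourier[OF Q, of m] by (simp add: b_def)
  have i3: "((\<lambda>t. cis (- real m * t)) has_integral 0) {0..2*pi}"
    using fourier[of "\<lambda>_. 1" m] m by (simp add: higher_deriv_const)
  have i4: "((\<lambda>t. Q (\<rho> * cis t) * cnj (s t)) has_integral 2 * pi * a * cnj a + 2 * pi * b * cnj b) {0..2*pi}"
    using has_integral_add[OF has_integral_mult_left[OF i1, of "cnj a"] has_integral_mult_left[OF i2, of "cnj b"]]
    by (simp add: cnj_s algebra_simps)
  have i4': "((\<lambda>t. 2 * Re (Q (\<rho> * cis t) * cnj (s t))) has_integral 2 * (2 * pi * ((cmod a)\<^sup>2 + (cmod b)\<^sup>2))) {0..2*pi}"
    using has_integral_mult_right[OF has_integral_Re[OF i4], of 2]
    unfolding cmod_power2 by (simp add: algebra_simps power2_eq_square)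
  have s2: "(cmod (s t))\<^sup>2 = (cmod a)\<^sup>2 + (cmod b)\<^sup>2 + 2 * Re (a * cnj b * cis (- real m * t))" for t
  proof -
    have "(cmod (s t))\<^sup>2 = Re (s t * cnj (s t))" by (simp only: complex_norm_square[symmetric] Re_complex_of_real)
    also have "s t * cnj (s t) = a * cnj a + b * cnj b * (cis (real m * t) * cis (- real m * t))
         + (a * cnj b * cis (- real m * t) + cnj (a * cnj b * cis (- real m * t)))"
      by (simp add: s_def cis_cnj algebra_simps)
    also have "cis (real m * t) * cis (- real m * t) = 1" by (simp add: cis_mult)
    finally show ?thesis unfolding cmod_power2 by (simp add: power2_eq_square algebra_simps)
  qed
  have i5: "((\<lambda>t. (cmod (s t))\<^sup>2) has_integral 2 * pi * ((cmod a)\<^sup>2 + (cmod b)\<^sup>2)) {0..2*pi}"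
  proof -
    have "((\<lambda>t. ((cmod a)\<^sup>2 + (cmod b)\<^sup>2) + 2 * Re (a * cnj b * cis (- real m * t))) has_integral
        (2 * pi) * ((cmod a)\<^sup>2 + (cmod b)\<^sup>2) + 2 * Re (a * cnj b * 0)) {0..2*pi}"
      using has_integral_const_real[of "(cmod a)\<^sup>2 + (cmod b)\<^sup>2" 0 "2*pi"]
      by (intro has_integral_add has_integral_mult_right has_integral_Re i3) simp
    then show ?thesis by (simp add: s2)
  qed
  have low: "2 * Re (Q (\<rho> * cis t) * cnj (s t)) - (cmod (s t))\<^sup>2 \<le> (cmod (Q (\<rho> * cis t)))\<^sup>2" for t
  proof -
    have "0 \<le> (cmod (Q (\<rho> * cis t) - s t))\<^sup>2" by simp
    also have "\<dots> = (cmod (Q (\<rho> * cis t)))\<^sup>2 - 2 * Re (Q (\<rho> * cis t) * cnj (s t)) + (cmod (s t))\<^sup>2"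
      unfolding cmod_power2 by (simp add: power2_eq_square algebra_simps)
    finally show ?thesis by simp
  qed
  have "continuous_on {0..2*pi} (\<lambda>t. (cmod (Q (\<rho> * cis t)))\<^sup>2)"
    using \<rho> by (intro continuous_intros continuous_on_compose2[OF holomorphic_on_imp_continuous_on[OF Q]])
      (auto simp: norm_mult)
  then obtain J where J: "((\<lambda>t. (cmod (Q (\<rho> * cis t)))\<^sup>2) has_integral J) {0..2*pi}"
    using integrable_continuous_interval by blast
  have "2 * (2 * pi * ((cmod a)\<^sup>2 + (cmod b)\<^sup>2)) - 2 * pi * ((cmod a)\<^sup>2 + (cmod b)\<^sup>2) \<le> J"
    by (rule has_integral_le[OF has_integral_diff[OF i4' i5] J]) (use low in auto)
  then have "J \<ge> 2 * pi * ((cmod a)\<^sup>2 + (cmod b)\<^sup>2)" by simp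
  also have "(cmod b)\<^sup>2 = (cmod ((deriv ^^ m) Q 0 / fact m))\<^sup>2 * \<rho> ^ (2 * m)"
    using \<rho> by (simp add: b_def norm_mult norm_power norm_divide power_mult_distrib power_divide power_mult[symmetric] mult.commute)
  finally show thesis using that J by (simp add: a_def)
qed

text \<open>Injectivity makes the area of the image of the annulus equal to the integral of |H'|^2,
  and the image lies in a disk of radius \<open>M\<close>. In polar coordinates the integral is
  taken circle by circle, where \<open>\<phi>\<close> bounds it from below.\<close>

lemma polar_area_le:
  assumes holH: "H holomorphic_on ball 0 1 - {0}" and inj: "inj_on H (ball 0 1 - {0})"
    and \<epsilon>: "0 < \<epsilon>" and r: "\<epsilon> < r" "r < 1"
    and bound: "\<And>z. \<epsilon> < cmod z \<Longrightarrow> cmod z < r \<Longrightarrow> cmod (H z) \<le> M"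
    and \<phi>: "(\<phi> has_integral I) {\<epsilon><..<r}" "\<And>\<rho>. \<epsilon> < \<rho> \<Longrightarrow> \<rho> < r \<Longrightarrow> 0 \<le> \<phi> \<rho>"
    and circle: "\<And>\<rho>. \<epsilon> < \<rho> \<Longrightarrow> \<rho> < r \<Longrightarrow>
        \<exists>J. ((\<lambda>t. \<rho> * (cmod (deriv H (\<rho> * cis t)))\<^sup>2) has_integral J) {0..2*pi} \<and> \<phi> \<rho> \<le> J"
  shows "I \<le> pi * M\<^sup>2"
proof -
  have "M \<ge> 0"
  proof -
    have "cmod (H (of_real ((\<epsilon> + r) / 2))) \<le> M"
      by (rule bound) (use \<epsilon> r in \<open>auto simp: field_simps norm_divide simp del: of_real_add of_real_divide\<close>)
    then show ?thesis using norm_ge_zero order_trans by blast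
  qed
  define tv :: "complex \<Rightarrow> real^2" where "tv z = Re z *\<^sub>R axis 1 1 + Im z *\<^sub>R axis 2 1" for z
  \<comment> \<open>An open rectangle of radii and angles. Omitting the angles 0 and 2 pi makes
    polar coordinates injective and leaves the circle integrals unchanged.\<close>
  define S :: "(real^2) set" where "S = {v. \<epsilon> < v$1 \<and> v$1 < r \<and> 0 < v$2 \<and> v$2 < 2*pi}"
  define Z :: "real^2 \<Rightarrow> complex" where "Z v = v$1 * cis (v$2)" for v
  define Z' :: "real^2 \<Rightarrow> real^2 \<Rightarrow> complex" where "Z' v h = h$1 * cis (v$2) + v$1 * (h$2 * (\<i> * cis (v$2)))" for v h
  define G' where "G' v h = tv (deriv H (Z v) * Z' v h)" for v h
  have tv_nth [simp]: "tv z $ 1 = Re z" "tv z $ 2 = Im z" for z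
    by (auto simp: tv_def axis_def)
  have norm_tv: "norm (tv z) = cmod z" for z
    by (simp add: norm_vec_def L2_set_def UNIV_2 cmod_def)
  have tv_inj: "tv z = tv w \<Longrightarrow> z = w" for z w
    by (metis tv_nth complex_eqI)
  have "S = box (vector [\<epsilon>, 0]) (vector [r, 2*pi])"
    by (auto simp: S_def mem_box Basis_vec_def inner_axis forall_2)
  then have "open S" and Sleb: "S \<in> sets lebesgue" by auto
  have [measurable]: "S \<in> sets borel" using \<open>open S\<close> by auto
  have normZ: "cmod (Z v) = \<bar>v$1\<bar>" for v
    by (simp add: Z_def norm_mult)
  have ZS: "Z v \<in> ball 0 1 - {0}" "\<epsilon> < cmod (Z v)" "cmod (Z v) < r" if "v \<in> S" for v
    using that \<epsilon> r normZ[of v] by (auto simp: S_def)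
  have opn: "open (ball 0 1 - {0 :: complex})" by auto
  have derZ: "(Z has_derivative Z' v) (at v within S)" for v
  proof -
    have *: "Z = (\<lambda>v. of_real (v$1) * exp (\<i> * of_real (v$2)))"
      by (auto simp: Z_def cis_conv_exp)
    have l: "((\<lambda>v::real^2. v $ i) has_derivative (\<lambda>h. h $ i)) (at v within S)" for i
      by (rule bounded_linear_imp_has_derivative[OF bounded_linear_vec_nth])
    have e: "((\<lambda>v::real^2. exp (\<i> * of_real (v$2))) has_derivative
        (\<lambda>h. exp (\<i> * of_real (v$2)) * (\<i> * of_real (h$2)))) (at v within S)"
      by (rule has_derivative_compose[OF _ DERIV_exp[THEN has_field_derivative_imp_has_derivative]])
        (intro has_derivative_mult_right has_derivative_of_real l)
    show ?thesis
      unfolding * Z'_def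
      by (rule has_derivative_eq_rhs[OF has_derivative_mult[OF has_derivative_of_real[OF l] e]])
        (auto simp: cis_conv_exp algebra_simps)
  qed
  have derG: "(tv \<circ> H \<circ> Z has_derivative G' v) (at v within S)" if "v \<in> S" for v
  proof -
    have "(H has_field_derivative deriv H (Z v)) (at (Z v))"
      using holH opn ZS(1)[OF that] by (rule holomorphic_derivI)
    then have "(H has_derivative (*) (deriv H (Z v))) (at (Z v))"
      by (simp add: has_field_derivative_def)
    then have "((\<lambda>v. H (Z v)) has_derivative (\<lambda>h. deriv H (Z v) * Z' v h)) (at v within S)"
      by (rule has_derivative_compose[OF derZ])
    moreover have "bounded_linear tv"
      unfolding tv_def by (intro bounded_linear_intros bounded_linear_Re bounded_linear_Im)
    ultimately show ?thesis
      unfolding o_def G'_def by (intro bounded_linear.has_derivative[of tv])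
  qed
  have injZ: "inj_on Z S"
  proof (rule inj_onI)
    fix v w assume vw: "v \<in> S" "w \<in> S" "Z v = Z w"
    have 1: "v$1 = w$1" using vw normZ[of v] normZ[of w] \<epsilon> by (auto simp: S_def)
    have "cis (v$2) = cis (w$2)"
      using vw 1 \<epsilon> by (auto simp: Z_def S_def)
    then obtain n :: int where n: "v$2 = w$2 + 2*pi*n"
      using sin_cos_eq_iff[of "v$2" "w$2"] by (auto simp: complex_eq_iff)
    have "0 < v$2" "v$2 < 2*pi" "0 < w$2" "w$2 < 2*pi"
      using vw by (auto simp: S_def)
    with n have "2*pi * real_of_int n < 2*pi * 1" "2*pi * (-1) < 2*pi * real_of_int n"
      by linarith+
    then have "real_of_int n < 1" "-1 < real_of_int n"
      by (simp_all only: mult_less_cancel_left_pos pi_gt_zero zero_less_mult_iff zero_less_numeral simp_thms)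
    then have "n = 0" by linarith
    with n have "v$2 = w$2" by simp
    with 1 show "v = w" by (simp add: vec_eq_iff forall_2)
  qed
  have injG: "inj_on (tv \<circ> H \<circ> Z) S"
  proof (rule inj_onI)
    fix v w assume vw: "v \<in> S" "w \<in> S" and "(tv \<circ> H \<circ> Z) v = (tv \<circ> H \<circ> Z) w"
    then have "H (Z v) = H (Z w)" using tv_inj by auto
    then have "Z v = Z w" using inj_onD[OF inj] ZS(1) vw by blast
    then show "v = w" using inj_onD[OF injZ] vw by blast
  qed
  \<comment> \<open>Multiplication by \<open>deriv H\<close> scales area by its squared modulus;
    polar coordinates contribute the factor \<open>v$1\<close>.\<close>
  have det: "\<bar>det (matrix (G' v))\<bar> = v$1 * (cmod (deriv H (Z v)))\<^sup>2" if "v \<in> S" for v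
  proof -
    have *: "det (matrix (G' v)) = v$1 * (cmod (deriv H (Z v)))\<^sup>2 * ((cos (v$2))\<^sup>2 + (sin (v$2))\<^sup>2)"
      unfolding cmod_power2
      by (simp add: det_2 matrix_def G'_def Z'_def axis_def power2_eq_square algebra_simps
               del: sin_cos_squared_add sin_cos_squared_add2 sin_cos_squared_add3)
    show ?thesis using that \<epsilon> unfolding * by (simp add: S_def)
  qed
  define A where "A = (tv \<circ> H \<circ> Z) ` S"
  have Asub: "A \<subseteq> cball 0 M"
    using ZS bound by (auto simp: A_def norm_tv)
  have "A \<in> sets lebesgue"
    unfolding A_def by (rule differentiable_image_in_sets_lebesgue[OF Sleb])
      (use derG in \<open>auto simp: differentiable_on_def differentiable_def\<close>)
  then have Ameas: "A \<in> lmeasurable"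
    using Asub bounded_set_imp_lmeasurable bounded_subset bounded_cball by blast
  have "measure lebesgue A \<le> measure lebesgue (cball (0::real^2) M)"
    using Asub Ameas by (intro measure_mono_fmeasurable) auto
  also have "\<dots> = pi * M\<^sup>2"
    using circle_area[OF \<open>M \<ge> 0\<close>, of 0] by (simp add: content_cball_conv_ball)
  finally have area: "measure lebesgue A \<le> pi * M\<^sup>2" .
  have "((\<lambda>v. \<bar>det (matrix (G' v))\<bar>) has_integral measure lebesgue A) S"
    using has_measure_differentiable_image[OF Sleb derG injG, of "measure lebesgue A"] Ameas by (simp add: A_def)
  then have intA: "((\<lambda>v. v$1 * (cmod (deriv H (Z v)))\<^sup>2) has_integral measure lebesgue A) S"
    using det by (simp cong: has_integral_cong)
  have pos: "0 \<le> v$1 * (cmod (deriv H (Z v)))\<^sup>2" if "v \<in> S" for v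
    using that \<epsilon> by (simp add: S_def)
  have contH: "continuous_on (ball 0 1 - {0}) (deriv H)"
    using holomorphic_deriv[OF holH opn] holomorphic_on_imp_continuous_on by blast
  have contF: "continuous_on S (\<lambda>v. v$1 * (cmod (deriv H (Z v)))\<^sup>2)"
    by (intro continuous_intros continuous_on_compose2[OF contH]) (use ZS in \<open>auto simp: Z_def cis_conv_exp intro!: continuous_intros\<close>)
  have [measurable]: "(\<lambda>v. indicator S v * (v$1 * (cmod (deriv H (Z v)))\<^sup>2)) \<in> borel_measurable borel"
    using borel_measurable_continuous_on_indicator[OF _ contF] by simp
  have "ennreal I = (\<integral>\<^sup>+\<rho>. indicator {\<epsilon><..<r} \<rho> * \<phi> \<rho> \<partial>lborel)"
    using nn_integral_has_integral_lebesgue[OF _ \<phi>(1)] \<phi>(2) by simp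
  \<comment> \<open>On each circle \<open>\<phi> \<rho>\<close> is at most the inner integral;
    Tonelli then assembles the circles into the area integral over \<open>S\<close>.\<close>
  also have "\<dots> \<le> (\<integral>\<^sup>+\<rho>. \<integral>\<^sup>+t. ennreal (indicator S (vector [\<rho>, t]) * (\<rho> * (cmod (deriv H (Z (vector [\<rho>, t]))))\<^sup>2)) \<partial>lborel \<partial>lborel)"
  proof (rule nn_integral_mono)
    fix \<rho> :: real
    show "ennreal (indicator {\<epsilon><..<r} \<rho> * \<phi> \<rho>) \<le> (\<integral>\<^sup>+t. ennreal (indicator S (vector [\<rho>, t]) * (\<rho> * (cmod (deriv H (Z (vector [\<rho>, t]))))\<^sup>2)) \<partial>lborel)"
    proof (cases "\<rho> \<in> {\<epsilon><..<r}")
      case True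
      then obtain J where J: "((\<lambda>t. \<rho> * (cmod (deriv H (\<rho> * cis t)))\<^sup>2) has_integral J) {0..2*pi}" "\<phi> \<rho> \<le> J"
        using circle[of \<rho>] by auto
      have J': "((\<lambda>t. \<rho> * (cmod (deriv H (\<rho> * cis t)))\<^sup>2) has_integral J) {0<..<2*pi}"
        using J(1) by (simp add: has_integral_Icc_iff_Ioo)
      have "ennreal (\<phi> \<rho>) \<le> ennreal J" using J(2) by (rule ennreal_leI)
      also have "ennreal J = (\<integral>\<^sup>+t. indicator {0<..<2*pi} t * (\<rho> * (cmod (deriv H (\<rho> * cis t)))\<^sup>2) \<partial>lborel)"
        using True \<epsilon> by (subst nn_integral_has_integral_lebesgue[OF _ J']) auto
      also have "\<dots> = (\<integral>\<^sup>+t. ennreal (indicator S (vector [\<rho>, t]) * (\<rho> * (cmod (deriv H (Z (vector [\<rho>, t]))))\<^sup>2)) \<partial>lborel)"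
        using True by (intro nn_integral_cong) (auto simp: S_def Z_def indicator_def)
      finally show ?thesis using True by simp
    qed auto
  qed
  also have "\<dots> = (\<integral>\<^sup>+v. ennreal (indicator S v * (v$1 * (cmod (deriv H (Z v)))\<^sup>2)) \<partial>lborel)"
    by (subst nn_integral_real2) auto
  also have "\<dots> = ennreal (measure lebesgue A)"
    using nn_integral_has_integral_lebesgue[OF pos intA] by simp
  finally have "I \<le> measure lebesgue A" by (simp add: ennreal_le_iff)
  with area show ?thesis by simp
qed

section \<open>Univalent functions\<close>

text \<open>Gronwall's area theorem for \<open>g(\<zeta>) = \<zeta> u(\<zeta>\<^sup>-\<^sup>3)\<close>, written in the variable \<open>z = 1/\<zeta>\<close> and for one coefficient at a
  time. The exponent \<open>3\<close> makes \<open>g\<close> so close to the identity at infinity that the image of a circle of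
  radius \<open>R\<close> lies in a disk whose area exceeds \<open>\<pi> R\<^sup>2\<close> only by \<open>o(1)\<close>; for an odd \<open>g\<close> one would have
  to use ellipses.\<close>

lemma area_theorem:
  assumes holu: "u holomorphic_on ball 0 1" and nz: "\<And>z. z \<in> ball 0 1 \<Longrightarrow> u z \<noteq> 0" and u0: "u 0 = 1"
    and inj: "inj_on (\<lambda>z. z / u (z ^ 3)) (ball 0 1)" and k: "k \<ge> 1"
  shows "(3 * real k - 1) * (cmod ((deriv ^^ k) u 0 / fact k))\<^sup>2 \<le> 1"
proof -
  define c where "c = (deriv ^^ k) u 0 / fact k"
  \<comment> \<open>\<open>H\<close> is the map g of the area theorem in the variable z = 1/zeta,
    and \<open>h\<close> is its reciprocal, the given univalent function. \<open>Q\<close> is z^2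
    H'(z), which extends holomorphically over 0.\<close>
  define H where "H z = u (z ^ 3) / z" for z
  define h where "h z = z / u (z ^ 3)" for z
  define Q where "Q z = 3 * z ^ 3 * deriv u (z ^ 3) - u (z ^ 3)" for z
  define A where "A = (3 * real k - 1)\<^sup>2 * (cmod c)\<^sup>2"
  define B where "B = (3 * real k - 1) * (cmod c)\<^sup>2"
  have cube: "z ^ 3 \<in> ball 0 1" if "z \<in> ball 0 1" for z :: complex
    using that by (simp add: norm_power power_less_one_iff)
  have holu3: "(\<lambda>z. u (z ^ 3)) holomorphic_on ball 0 1"
    using holomorphic_on_compose_gen[OF _ holu, of "\<lambda>z. z ^ 3" "ball 0 1"] cube
    by (force simp: o_def intro!: holomorphic_intros)
  have hold: "deriv u holomorphic_on ball 0 1"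
    using holu by (intro holomorphic_deriv) auto
  have holdu3: "(\<lambda>z. deriv u (z ^ 3)) holomorphic_on ball 0 1"
    using holomorphic_on_compose_gen[OF _ hold, of "\<lambda>z. z ^ 3" "ball 0 1"] cube
    by (force simp: o_def intro!: holomorphic_intros)
  have holQ: "Q holomorphic_on ball 0 1"
    unfolding Q_def by (intro holomorphic_intros holu3 holdu3)
  have holH: "H holomorphic_on ball 0 1 - {0}"
    unfolding H_def by (intro holomorphic_intros holomorphic_on_subset[OF holu3]) auto
  have holh: "h holomorphic_on ball 0 1"
    unfolding h_def using nz cube by (intro holomorphic_intros holu3) auto
  have injh: "inj_on h (ball 0 1)" using inj by (simp add: h_def[abs_def])
  have Hh: "H z = inverse (h z)" for z by (simp add: H_def h_def)
  have injH: "inj_on H (ball 0 1 - {0})"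
    using injh unfolding inj_on_def Hh by auto
  have derivH: "deriv H z = Q z / z\<^sup>2" if z: "z \<in> ball 0 1 - {0}" for z
  proof -
    have u': "(u has_field_derivative deriv u (z ^ 3)) (at (z ^ 3))"
      using holu cube[of z] z by (intro holomorphic_derivI) auto
    have "((\<lambda>z. z ^ 3) has_field_derivative 3 * z\<^sup>2) (at z)"
      by (auto intro!: derivative_eq_intros)
    with u' have "((\<lambda>z. u (z ^ 3)) has_field_derivative deriv u (z ^ 3) * (3 * z\<^sup>2)) (at z)"
      by (rule DERIV_chain2[where g = "\<lambda>z. z ^ 3"])
    then have "(H has_field_derivative (deriv u (z ^ 3) * (3 * z\<^sup>2) * z - u (z ^ 3) * 1) / (z * z)) (at z)"
      unfolding H_def using z by (intro DERIV_divide) auto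
    then show ?thesis
      using z by (auto dest!: DERIV_imp_deriv simp: Q_def power2_eq_square power3_eq_cube algebra_simps)
  qed
  \<comment> \<open>At z^(3k) the term 3 z^3 u'(z^3) contributes 3k c and -u(z^3) contributes
    -c.\<close>
  have coeffQ: "(deriv ^^ (3 * k)) Q 0 / fact (3 * k) = (3 * of_nat k - 1) * c"
  proof -
    define U where "U = fps_expansion u 0"
    have U: "u has_fps_expansion U"
      unfolding U_def using holu by (intro has_fps_expansion_fps_expansion[of "ball 0 1"]) auto
    have comp: "(\<lambda>z. f (z ^ 3)) has_fps_expansion fps_compose F (fps_X ^ 3)"
      if "f has_fps_expansion F" for f :: "complex \<Rightarrow> complex" and F
      using has_fps_expansion_compose[OF that has_fps_expansion_fps_X_power[of 3]] by (simp add: o_def)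
    have "Q has_fps_expansion 3 * fps_X ^ 3 * fps_compose (fps_deriv U) (fps_X ^ 3) - fps_compose U (fps_X ^ 3)"
      unfolding Q_def by (intro fps_expansion_intros comp U)
    from fps_nth_fps_expansion[OF this, of "3 * k"]
    have "(deriv ^^ (3 * k)) Q 0 / fact (3 * k)
        = fps_nth (3 * fps_X ^ 3 * fps_compose (fps_deriv U) (fps_X ^ 3) - fps_compose U (fps_X ^ 3)) (3 * k)" ..
    also have "\<dots> = (3 * of_nat k - 1) * fps_nth U k"
      using k by (cases k) (auto simp: numeral_fps_const mult.assoc fps_X_power_mult_nth fps_nth_compose_X_power algebra_simps)
    also have "fps_nth U k = c"
      using fps_nth_fps_expansion[OF U, of k] by (simp add: c_def)
    finally show ?thesis .
  qed
  obtain C where C: "C \<ge> 0" "\<And>z. cmod z \<le> 1/2 \<Longrightarrow> cmod (u z - 1) \<le> C * cmod z"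
  proof -
    have "continuous_on (cball 0 (1/2)) (deriv u)"
      by (intro holomorphic_on_imp_continuous_on holomorphic_on_subset[OF hold]) auto
    then have "bounded (deriv u ` cball 0 (1/2))"
      by (intro compact_imp_bounded compact_continuous_image) auto
    then obtain C where C: "C > 0" "\<And>z. z \<in> cball 0 (1/2) \<Longrightarrow> cmod (deriv u z) \<le> C"
      unfolding bounded_pos by auto
    have "cmod (u z - u 0) \<le> C * cmod (z - 0)" if "cmod z \<le> 1/2" for z
    proof (rule field_differentiable_bound[of "cball 0 (1/2)" u "deriv u"])
      show "(u has_field_derivative deriv u x) (at x within cball 0 (1/2))" if "x \<in> cball 0 (1/2)" for x
        by (rule has_field_derivative_at_within[OF holomorphic_derivI[OF holu]]) (use that in auto)
    qed (use that C in auto)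
    then show thesis using C u0 by (intro that[of C]) auto
  qed
  \<comment> \<open>Area inequality on the annulus between \<epsilon> and r. The divergent term
    1/\<epsilon>^2 occurs on both sides and cancels; the remaining error vanishes with
    \<epsilon>.\<close>
  have key: "B * (r ^ (6 * k - 2) - \<epsilon> ^ (6 * k - 2)) \<le> 1 / r\<^sup>2 + 2 * C * \<epsilon> + C\<^sup>2 * \<epsilon> ^ 4"
    if \<epsilon>: "0 < \<epsilon>" "\<epsilon> < 1/2" and r: "\<epsilon> < r" "r < 1" for \<epsilon> r
  proof -
    define M where "M = (1 + C * \<epsilon> ^ 3) / \<epsilon>"
    have Mpos: "M > 0" using \<epsilon> C(1) unfolding M_def by (intro divide_pos_pos add_pos_nonneg) auto
    have sph: "1 / M \<le> cmod (h z)" if z: "cmod z = \<epsilon>" for z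
    proof -
      have "cmod (z ^ 3) \<le> \<epsilon> ^ 1"
        unfolding norm_power z using \<epsilon> by (intro power_decreasing) auto
      then have "cmod (z ^ 3) \<le> 1/2" using \<epsilon> by simp
      from C(2)[OF this] have "cmod (u (z ^ 3) - 1) \<le> C * \<epsilon> ^ 3" by (simp add: norm_power z)
      then have "cmod (u (z ^ 3)) \<le> 1 + C * \<epsilon> ^ 3"
        using norm_triangle_ineq[of "u (z ^ 3) - 1" 1] by simp
      moreover have "u (z ^ 3) \<noteq> 0" using nz cube[of z] z \<epsilon> by auto
      ultimately show ?thesis
        using \<epsilon> z by (auto simp: h_def M_def norm_divide intro!: divide_left_mono mult_pos_pos intro: less_le_trans[of 0 "cmod (u (z ^ 3))"])
    qed
    \<comment> \<open>Since |h| is at least 1/M on the circle of radius \<epsilon>, the image of its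
      interior covers the disk of radius 1/M. By injectivity |h| stays at least 1/M outside, which
      bounds |H| by \<open>M\<close> on the whole annulus.\<close>
    have sub: "ball (h 0) (1 / M) \<subseteq> h ` ball 0 \<epsilon>"
    proof (rule ball_subset_open_map_image)
      show "continuous_on (closure (ball 0 \<epsilon>)) h"
        by (rule holomorphic_on_imp_continuous_on, rule holomorphic_on_subset[OF holh]) (use \<epsilon> in auto)
      show "open (h ` interior (ball 0 \<epsilon>))"
        using \<epsilon> by (auto intro!: open_mapping_thm3 holomorphic_on_subset[OF holh] inj_on_subset[OF injh])
      show "1 / M \<le> cmod (h z - h 0)" if "z \<in> frontier (ball 0 \<epsilon>)" for z
        using sph[of z] that \<epsilon> by (simp add: frontier_ball h_def)
    qed (use \<epsilon> Mpos in auto)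
    have bound: "cmod (H z) \<le> M" if z: "\<epsilon> < cmod z" "cmod z < r" for z
    proof (rule ccontr)
      assume "\<not> ?thesis"
      then have "M < cmod (H z)" by simp
      then have "cmod (h z) < 1 / M"
        using Mpos by (cases "h z = 0") (auto simp: Hh norm_divide field_simps)
      then have "h z \<in> ball (h 0) (1 / M)" by (simp add: h_def)
      then obtain z' where "z' \<in> ball 0 \<epsilon>" "h z = h z'" using sub by blast
      then have "z = z'" using injh z \<epsilon> r by (auto dest!: inj_onD)
      then show False using \<open>z' \<in> ball 0 \<epsilon>\<close> z by auto
    qed
    \<comment> \<open>\<open>\<phi>\<close> is the mean-square lower bound for \<open>Q\<close>,
      divided by \<rho>^3 because \<rho> |H'|^2 = |Q|^2 / \<rho>^3. \<open>\<Phi>\<close> is its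
      antiderivative; B (6k - 2) = 2A matches the coefficients, and k >= 1 makes the natural
      subtractions exact.\<close>
    define \<phi> where "\<phi> \<rho> = 2 * pi * (1 / \<rho> ^ 3 + A * \<rho> ^ (6 * k - 3))" for \<rho> :: real
    define \<Phi> where "\<Phi> \<rho> = pi * (B * \<rho> ^ (6 * k - 2) - 1 / \<rho>\<^sup>2)" for \<rho> :: real
    have AB: "B * real (6 * k - 2) = 2 * A"
      using k by (simp add: A_def B_def of_nat_diff power2_eq_square algebra_simps)
    have "(\<Phi> has_vector_derivative \<phi> \<rho>) (at \<rho> within {\<epsilon>..r})" if "\<rho> \<in> {\<epsilon>..r}" for \<rho>
    proof -
      have "\<rho> > 0" using that \<epsilon> by auto
      have d1: "((\<lambda>\<rho>. 1 / \<rho>\<^sup>2) has_real_derivative - 2 / \<rho> ^ 3) (at \<rho> within {\<epsilon>..r})"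
        using \<open>\<rho> > 0\<close>
        by (auto intro!: derivative_eq_intros simp: divide_simps power2_eq_square power3_eq_cube)
      have d2: "((\<lambda>\<rho>. \<rho> ^ (6 * k - 2)) has_real_derivative real (6 * k - 2) * \<rho> ^ (6 * k - 2 - 1)) (at \<rho> within {\<epsilon>..r})"
        unfolding One_nat_def by (rule DERIV_pow)
      have "(\<Phi> has_real_derivative pi * (B * (real (6 * k - 2) * \<rho> ^ (6 * k - 2 - 1)) - (- 2 / \<rho> ^ 3))) (at \<rho> within {\<epsilon>..r})"
        unfolding \<Phi>_def by (intro DERIV_cmult DERIV_diff d1 d2)
      moreover have "pi * (B * (real (6 * k - 2) * \<rho> ^ (6 * k - 2 - 1)) - (- 2 / \<rho> ^ 3)) = \<phi> \<rho>"
      proof -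
        have *: "B * (real (6 * k - 2) * \<rho> ^ (6 * k - 2 - 1)) = 2 * A * \<rho> ^ (6 * k - 3)"
          unfolding AB[symmetric] by (simp add: mult.assoc numeral_3_eq_3)
        show ?thesis unfolding * \<phi>_def by (simp add: algebra_simps)
      qed
      ultimately show ?thesis by (simp add: has_real_derivative_iff_has_vector_derivative)
    qed
    then have "(\<phi> has_integral \<Phi> r - \<Phi> \<epsilon>) {\<epsilon>..r}"
      using r by (intro fundamental_theorem_of_calculus) auto
    then have int\<phi>: "(\<phi> has_integral \<Phi> r - \<Phi> \<epsilon>) {\<epsilon><..<r}"
      by (simp add: has_integral_Icc_iff_Ioo)
    have circle: "\<exists>J. ((\<lambda>t. \<rho> * (cmod (deriv H (\<rho> * cis t)))\<^sup>2) has_integral J) {0..2*pi} \<and> \<phi> \<rho> \<le> J"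
      if \<rho>: "\<epsilon> < \<rho>" "\<rho> < r" for \<rho>
    proof -
      have \<rho>': "0 < \<rho>" "\<rho> < 1" using \<rho> \<epsilon> r by auto
      obtain J where J: "((\<lambda>t. (cmod (Q (\<rho> * cis t)))\<^sup>2) has_integral J) {0..2*pi}"
        and Jge: "J \<ge> 2 * pi * ((cmod (Q 0))\<^sup>2 + (cmod ((deriv ^^ (3 * k)) Q 0 / fact (3 * k)))\<^sup>2 * \<rho> ^ (2 * (3 * k)))"
        using mean_square_ge[OF holQ \<rho>', of "3 * k"] k by auto
      have "cmod (3 * of_nat k - 1) = 3 * real k - 1"
      proof -
        have "(3 * of_nat k - 1 :: complex) = of_real (3 * real k - 1)" by simp
        then show ?thesis using k by (simp only: norm_of_real)
      qed
      then have Jge': "J \<ge> 2 * pi * (1 + A * \<rho> ^ (6 * k))"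
        using Jge unfolding coeffQ by (simp add: Q_def u0 A_def norm_mult power_mult_distrib)
      have "\<rho> * (cmod (deriv H (\<rho> * cis t)))\<^sup>2 = 1 / \<rho> ^ 3 * (cmod (Q (\<rho> * cis t)))\<^sup>2" for t
        using \<rho>' by (subst derivH) (auto simp: norm_mult norm_divide norm_power power_divide power2_eq_square power3_eq_cube)
      then have "((\<lambda>t. \<rho> * (cmod (deriv H (\<rho> * cis t)))\<^sup>2) has_integral 1 / \<rho> ^ 3 * J) {0..2*pi}"
        using has_integral_mult_right[OF J, of "1 / \<rho> ^ 3"] by simp
      moreover have "\<phi> \<rho> \<le> 1 / \<rho> ^ 3 * J"
      proof -
        have e: "\<rho> ^ (6 * k) = \<rho> ^ (6 * k - 3) * \<rho> ^ 3"
          using k by (simp flip: power_add)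
        have "\<phi> \<rho> = 1 / \<rho> ^ 3 * (2 * pi * (1 + A * \<rho> ^ (6 * k)))"
          using \<rho>' unfolding e \<phi>_def by (simp add: field_simps)
        also have "\<dots> \<le> 1 / \<rho> ^ 3 * J"
          using Jge' \<rho>' by (intro mult_left_mono) auto
        finally show ?thesis .
      qed
      ultimately show ?thesis by blast
    qed
    have "A \<ge> 0" by (simp add: A_def)
    have "\<Phi> r - \<Phi> \<epsilon> \<le> pi * M\<^sup>2"
      by (rule polar_area_le[OF holH injH \<epsilon>(1) r bound int\<phi> _ circle])
        (use \<open>A \<ge> 0\<close> \<epsilon> in \<open>auto simp: \<phi>_def\<close>)
    then have "pi * ((B * r ^ (6 * k - 2) - 1 / r\<^sup>2) - (B * \<epsilon> ^ (6 * k - 2) - 1 / \<epsilon>\<^sup>2)) \<le> pi * M\<^sup>2"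
      by (simp add: \<Phi>_def algebra_simps)
    then have "(B * r ^ (6 * k - 2) - 1 / r\<^sup>2) - (B * \<epsilon> ^ (6 * k - 2) - 1 / \<epsilon>\<^sup>2) \<le> M\<^sup>2"
      by (simp only: mult_le_cancel_left_pos pi_gt_zero)
    moreover have "M\<^sup>2 = 1 / \<epsilon>\<^sup>2 + 2 * C * \<epsilon> + C\<^sup>2 * \<epsilon> ^ 4"
      using \<epsilon> unfolding M_def by (simp add: field_simps eval_nat_numeral)
    ultimately show ?thesis by (simp add: algebra_simps)
  qed
  \<comment> \<open>First \<epsilon> tends to 0, using 6k - 2 > 0; afterwards r tends to 1.\<close>
  have lim\<epsilon>: "B * r ^ (6 * k - 2) \<le> 1 / r\<^sup>2" if r: "0 < r" "r < 1" for r
  proof (rule tendsto_le[of "at_right 0"])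
    show "((\<lambda>\<epsilon>. B * (r ^ (6 * k - 2) - \<epsilon> ^ (6 * k - 2))) \<longlongrightarrow> B * r ^ (6 * k - 2)) (at_right 0)"
      using k by (auto intro!: tendsto_eq_intros)
    show "((\<lambda>\<epsilon>. 1 / r\<^sup>2 + 2 * C * \<epsilon> + C\<^sup>2 * \<epsilon> ^ 4) \<longlongrightarrow> 1 / r\<^sup>2) (at_right 0)"
      by (auto intro!: tendsto_eq_intros)
    show "\<forall>\<^sub>F \<epsilon> in at_right 0. B * (r ^ (6 * k - 2) - \<epsilon> ^ (6 * k - 2)) \<le> 1 / r\<^sup>2 + 2 * C * \<epsilon> + C\<^sup>2 * \<epsilon> ^ 4"
      using eventually_at_right_real[of 0 "min r (1/2)"] r
      by (auto elim!: eventually_mono intro!: key)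
  qed simp
  have "B \<le> 1"
  proof (rule tendsto_le[of "at_left (1::real)"])
    show "((\<lambda>r. B * r ^ (6 * k - 2)) \<longlongrightarrow> B) (at_left 1)"
      by (auto intro!: tendsto_eq_intros)
    show "((\<lambda>r. 1 / r\<^sup>2) \<longlongrightarrow> (1::real)) (at_left 1)"
      by (auto intro!: tendsto_eq_intros)
    show "\<forall>\<^sub>F r in at_left 1. B * r ^ (6 * k - 2) \<le> 1 / r\<^sup>2"
      using eventually_at_left_real[of 0 1] by (auto elim!: eventually_mono intro!: lim\<epsilon>)
  qed simp
  then show ?thesis by (simp add: B_def c_def)
qed

text \<open>Injectivity makes f(w)/w zero-free on the disk, so it has a holomorphic logarithm, and
  \<open>u\<close> is a cube root of w/f(w). The area theorem bounds the squared modulus of each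
  coefficient by 1/(3k - 1), hence by 1/2; 5/7 is a rational upper bound for the square root of
  1/2.\<close>

lemma univalent_cube_root:
  assumes holf: "f holomorphic_on ball 0 1" and inj: "inj_on f (ball 0 1)" and f0: "f 0 = 0" and f': "deriv f 0 = 1"
  obtains u where "u holomorphic_on ball 0 1" "u 0 = 1" "\<And>w. w \<in> ball 0 1 \<Longrightarrow> u w \<noteq> 0"
    "\<And>w. w \<in> ball 0 1 \<Longrightarrow> f w * u w ^ 3 = w" "\<And>k. k \<ge> 1 \<Longrightarrow> cmod ((deriv ^^ k) u 0 / fact k) \<le> 5 / 7"
proof -
  \<comment> \<open>The quotient f(w)/w with its removable singularity filled in.\<close>
  define v where "v w = (if w = 0 then deriv f 0 else (f w - f 0) / (w - 0))" for w
  have holv: "v holomorphic_on ball 0 1"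
    unfolding v_def by (rule pole_lemma_open[OF holf]) auto
  have vnz: "v w \<noteq> 0" if "w \<in> ball 0 1" for w
  proof (cases "w = 0")
    case False
    then have "f w \<noteq> f 0" using inj_onD[OF inj, of w 0] that by auto
    with False show ?thesis by (simp add: v_def)
  qed (simp add: v_def f')
  obtain L where L: "L holomorphic_on ball 0 1" "\<And>w. w \<in> ball 0 1 \<Longrightarrow> exp (L w) = v w"
    using holomorphic_logarithm_exists[OF convex_ball open_ball holv vnz, of 0] by auto
  \<comment> \<open>Subtracting \<open>L\<close> from \<open>L 0\<close> selects the branch of the
    cube root with value 1 at 0.\<close>
  define u where "u w = exp ((L 0 - L w) / 3)" for w
  have u3: "u w ^ 3 = inverse (v w)" if "w \<in> ball 0 1" for w
  proof -
    have "u w ^ 3 = exp (of_nat 3 * ((L 0 - L w) / 3))"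
      by (simp only: u_def exp_of_nat_mult)
    also have "of_nat 3 * ((L 0 - L w) / 3) = L 0 - L w" by simp
    also have "exp \<dots> = inverse (v w)"
      using L(2)[of 0] L(2)[OF that] by (simp add: exp_diff v_def f' field_simps)
    finally show ?thesis .
  qed
  have holu: "u holomorphic_on ball 0 1"
    unfolding u_def by (intro holomorphic_intros L) auto
  have u0: "u 0 = 1" and unz: "u w \<noteq> 0" for w by (auto simp: u_def)
  have fu: "f w * u w ^ 3 = w" if "w \<in> ball 0 1" for w
    using u3[OF that] vnz[OF that] f0 by (cases "w = 0") (auto simp: v_def)
  \<comment> \<open>Cubing z/u(z^3) gives f(z^3), so equal values force equal cubes. Then the
    denominators agree as well, and therefore the points.\<close>
  have inju: "inj_on (\<lambda>z. z / u (z ^ 3)) (ball 0 1)"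
  proof (rule inj_onI)
    fix z z' :: complex assume z: "z \<in> ball 0 1" "z' \<in> ball 0 1" and eq: "z / u (z ^ 3) = z' / u (z' ^ 3)"
    have cube: "z ^ 3 \<in> ball 0 1" "z' ^ 3 \<in> ball 0 1"
      using z by (simp_all add: norm_power power_less_one_iff)
    have fcube: "f (z ^ 3) = (z / u (z ^ 3)) ^ 3" if "z ^ 3 \<in> ball 0 1" for z
      using fu[OF that] unz[of "z ^ 3"] by (simp add: power_divide field_simps)
    have "f (z ^ 3) = f (z' ^ 3)"
      using fcube[OF cube(1)] fcube[OF cube(2)] eq by simp
    then have "z ^ 3 = z' ^ 3" using inj_onD[OF inj] cube by blast
    with eq unz show "z = z'" by (simp add: divide_simps)
  qed
  have coeff: "cmod ((deriv ^^ k) u 0 / fact k) \<le> 5 / 7" if k: "k \<ge> 1" for k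
  proof -
    have "2 * (cmod ((deriv ^^ k) u 0 / fact k))\<^sup>2 \<le> (3 * real k - 1) * (cmod ((deriv ^^ k) u 0 / fact k))\<^sup>2"
      using k by (intro mult_right_mono) auto
    also have "\<dots> \<le> 1" by (rule area_theorem[OF holu unz u0 inju k])
    finally have "(cmod ((deriv ^^ k) u 0 / fact k))\<^sup>2 \<le> 1 / 2" by simp
    also have "1 / 2 \<le> (5 / 7 :: real)\<^sup>2" by (simp add: power2_eq_square)
    finally show ?thesis by (rule power2_le_imp_le) simp
  qed
  show thesis by (rule that[OF holu u0 unz fu coeff])
qed

section \<open>Distortion estimates from the coefficient bounds\<close>

lemma power_series_bounds:
  fixes u :: "complex \<Rightarrow> complex"
  assumes holu: "u holomorphic_on ball 0 1" and coeff: "\<And>k. k \<ge> 1 \<Longrightarrow> cmod ((deriv ^^ k) u 0 / fact k) \<le> C"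
    and w: "w \<in> ball 0 1"
  shows "cmod (u w - u 0) \<le> C * cmod w / (1 - cmod w)"
    and "cmod (deriv u w) \<le> C / (1 - cmod w)\<^sup>2"
proof -
  have w1: "cmod w < 1" using w by simp
  have "(\<lambda>n. (deriv ^^ n) u 0 / fact n * (w - 0) ^ n) sums u w"
    by (rule holomorphic_power_series[OF holu w])
  then have 1: "(\<lambda>n. (deriv ^^ Suc n) u 0 / fact (Suc n) * w ^ Suc n) sums (u w - u 0)"
    by (subst sums_Suc_iff) simp
  have 2: "(\<lambda>n. C * cmod w * cmod w ^ n) sums (C * cmod w * (1 / (1 - cmod w)))"
    using w1 by (intro sums_mult geometric_sums) simp
  have "cmod (u w - u 0) \<le> C * cmod w * (1 / (1 - cmod w))"
  proof (rule norm_sums_le[OF 1 2])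
    fix n
    have "cmod ((deriv ^^ Suc n) u 0 / fact (Suc n) * w ^ Suc n) = cmod ((deriv ^^ Suc n) u 0 / fact (Suc n)) * cmod w ^ Suc n"
      by (simp only: norm_mult norm_power)
    also have "\<dots> \<le> C * cmod w ^ Suc n"
      by (intro mult_right_mono coeff) auto
    finally show "cmod ((deriv ^^ Suc n) u 0 / fact (Suc n) * w ^ Suc n) \<le> C * cmod w * cmod w ^ n" by simp
  qed
  then show "cmod (u w - u 0) \<le> C * cmod w / (1 - cmod w)" by simp
  have "deriv u holomorphic_on ball 0 1"
    by (intro holomorphic_deriv holu) auto
  then have 3: "(\<lambda>n. (deriv ^^ n) (deriv u) 0 / fact n * (w - 0) ^ n) sums deriv u w"
    using w by (rule holomorphic_power_series)
  have 4: "(\<lambda>n. C * (of_nat (Suc n) * cmod w ^ n)) sums (C * (1 / (1 - cmod w)\<^sup>2))"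
    using w1 by (intro sums_mult geometric_deriv_sums) simp
  have "cmod (deriv u w) \<le> C * (1 / (1 - cmod w)\<^sup>2)"
  proof (rule norm_sums_le[OF 3 4])
    fix n
    have "(deriv ^^ n) (deriv u) 0 / fact n = of_nat (Suc n) * ((deriv ^^ Suc n) u 0 / fact (Suc n))"
      by (simp add: funpow_swap1 field_simps del: of_nat_Suc)
    then have "cmod ((deriv ^^ n) (deriv u) 0 / fact n * (w - 0) ^ n)
       = real (Suc n) * cmod ((deriv ^^ Suc n) u 0 / fact (Suc n)) * cmod w ^ n"
      by (simp only: norm_mult norm_power norm_of_nat diff_zero)
    also have "\<dots> \<le> real (Suc n) * C * cmod w ^ n"
      by (intro mult_right_mono mult_left_mono coeff) auto
    finally show "cmod ((deriv ^^ n) (deriv u) 0 / fact n * (w - 0) ^ n) \<le> C * (of_nat (Suc n) * cmod w ^ n)"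
      by (simp add: mult_ac)
  qed
  then show "cmod (deriv u w) \<le> C / (1 - cmod w)\<^sup>2" by simp
qed

text \<open>In the rescaled picture the first bound puts a whole disk around the root inside the
  branch, the second puts points of small value into that disk, and the third is the quadratic
  Newton estimate.\<close>

lemma univalent_bounds:
  assumes holf: "f holomorphic_on ball 0 1" and inj: "inj_on f (ball 0 1)" and f0: "f 0 = 0" and f': "deriv f 0 = 1"
  shows "ball 0 (1/8) \<subseteq> f ` ball 0 (1/4)"
    and "\<And>w. cmod w \<le> 23/250 \<Longrightarrow> cmod (f w) < 1/8"
    and "\<And>w. cmod w \<le> 1/4 \<Longrightarrow> cmod (f w - w * deriv f w) \<le> 6 * (cmod (f w))\<^sup>2"
proof -
  obtain u where holu: "u holomorphic_on ball 0 1" and u0: "u 0 = 1" and unz: "\<And>w. w \<in> ball 0 1 \<Longrightarrow> u w \<noteq> 0"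
    and fu: "\<And>w. w \<in> ball 0 1 \<Longrightarrow> f w * u w ^ 3 = w" and coeff: "\<And>k. k \<ge> 1 \<Longrightarrow> cmod ((deriv ^^ k) u 0 / fact k) \<le> 5 / 7"
    using univalent_cube_root[OF assms] by blast
  have ub: "cmod (u w - 1) \<le> 5/7 * s / (1 - s)" if "cmod w \<le> s" "s < 1" for w s
  proof -
    have "cmod (u w - 1) \<le> 5/7 * cmod w / (1 - cmod w)"
      using power_series_bounds(1)[OF holu coeff, of w] that u0 by simp
    also have "\<dots> \<le> 5/7 * s / (1 - s)"
      using that order_trans[OF norm_ge_zero that(1)] by (intro frac_le mult_left_mono) auto
    finally show ?thesis .
  qed
  \<comment> \<open>5/7 * (1/4) / (3/4) = 5/21.\<close>
  have u4: "cmod (u w) \<le> 26/21" if "cmod w \<le> 1/4" for w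
    using ub[OF that] norm_triangle_ineq[of "u w - 1" 1] by simp
  have norm_fu: "cmod (f w) * cmod (u w) ^ 3 = cmod w" if "w \<in> ball 0 1" for w
    using arg_cong[OF fu[OF that], of cmod] by (simp add: norm_mult norm_power)
  show "ball 0 (1/8) \<subseteq> f ` ball 0 (1/4)"
  proof -
    \<comment> \<open>(26/21)^3 < 2 gives |f| >= 1/8 on the circle |w| = 1/4, so by openness the
      image of its interior covers the disk of radius 1/8.\<close>
    have "ball (f 0) (1/8) \<subseteq> f ` ball 0 (1/4)"
    proof (rule ball_subset_open_map_image)
      show "continuous_on (closure (ball 0 (1/4))) f"
        by (rule holomorphic_on_imp_continuous_on, rule holomorphic_on_subset[OF holf]) auto
      show "open (f ` interior (ball 0 (1/4)))"
        by (auto intro!: open_mapping_thm3 holomorphic_on_subset[OF holf] inj_on_subset[OF inj])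
      show "1/8 \<le> cmod (f w - f 0)" if "w \<in> frontier (ball 0 (1/4))" for w
      proof -
        have w: "cmod w = 1/4" using that by (simp add: frontier_ball)
        have "1/4 = cmod (f w) * cmod (u w) ^ 3"
          using norm_fu[of w] w by simp
        also have "\<dots> \<le> cmod (f w) * (26/21) ^ 3"
          using u4[of w] w by (intro mult_left_mono power_mono) auto
        also have "\<dots> \<le> cmod (f w) * 2" by (intro mult_left_mono) (auto simp: power3_eq_cube)
        finally show ?thesis by (simp add: f0)
      qed
    qed auto
    then show ?thesis by (simp add: f0)
  qed
  show "cmod (f w) < 1/8" if w: "cmod w \<le> 23/250" for w
  proof -
    \<comment> \<open>The radius 23/250 = 0.092 lies just above \<beta>; it yields |u| >= 23/25 and
      |f| <= (23/250) / (23/25)^3 < 1/8.\<close>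
    have "cmod (u w - 1) \<le> 2/25" using ub[OF w] by simp
    moreover have "1 \<le> cmod (u w) + cmod (u w - 1)"
      using norm_triangle_ineq4[of "u w" "u w - 1"] by simp
    ultimately have "23/25 \<le> cmod (u w)" by simp
    then have "cmod (f w) * (23/25) ^ 3 \<le> cmod (f w) * cmod (u w) ^ 3"
      by (intro mult_left_mono power_mono) auto
    also have "\<dots> = cmod w"
      using norm_fu[of w] w by simp
    also have "\<dots> \<le> 23/250" by fact
    finally show ?thesis by (simp add: power3_eq_cube)
  qed
  show "cmod (f w - w * deriv f w) \<le> 6 * (cmod (f w))\<^sup>2" if w: "cmod w \<le> 1/4" for w
  proof -
    have wb: "w \<in> ball 0 1" using w by simp
    have 1: "(f has_field_derivative deriv f w) (at w)" "(u has_field_derivative deriv u w) (at w)"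
      using holf holu wb by (auto intro!: holomorphic_derivI)
    \<comment> \<open>Differentiating f u^3 = w and eliminating f' turns f - w f' into 3 f^2 u^2 u',
      which exhibits the factor f^2.\<close>
    have "((\<lambda>w. f w * u w ^ 3) has_field_derivative deriv f w * u w ^ 3 + 3 * f w * (u w)\<^sup>2 * deriv u w) (at w)"
      by (rule derivative_eq_intros 1 refl)+ (simp add: algebra_simps)
    moreover have "((\<lambda>w. f w * u w ^ 3) has_field_derivative 1) (at w)"
      by (rule has_field_derivative_transform_within_open[OF DERIV_ident open_ball wb]) (simp add: fu)
    ultimately have d: "deriv f w * u w ^ 3 + 3 * f w * (u w)\<^sup>2 * deriv u w = 1"
      using DERIV_unique by blast
    have "(f w - w * deriv f w) * u w ^ 3 = f w * u w ^ 3 - w * (1 - 3 * f w * (u w)\<^sup>2 * deriv u w)"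
      unfolding d[symmetric] by (simp add: algebra_simps)
    also have "\<dots> = 3 * (f w * u w ^ 3) * f w * (u w)\<^sup>2 * deriv u w"
      unfolding fu[OF wb] by (simp add: algebra_simps)
    finally have "f w - w * deriv f w = 3 * (f w)\<^sup>2 * (u w)\<^sup>2 * deriv u w"
      using unz[OF wb] by (simp add: power2_eq_square)
    then have "cmod (f w - w * deriv f w) = (cmod (f w))\<^sup>2 * (3 * (cmod (u w))\<^sup>2 * cmod (deriv u w))"
      by (simp add: norm_mult norm_power mult_ac)
    \<comment> \<open>80/63 = (5/7) / (3/4)^2 bounds u', and 3 (26/21)^2 (80/63) is about
      5.84.\<close>
    also have "\<dots> \<le> (cmod (f w))\<^sup>2 * (3 * (26/21)\<^sup>2 * (80/63))"
    proof (intro mult_left_mono mult_mono power_mono u4 w)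
      have "cmod (deriv u w) \<le> 5/7 / (1 - cmod w)\<^sup>2"
        by (rule power_series_bounds(2)[OF holu coeff wb])
      also have "\<dots> \<le> 5/7 / (3/4)\<^sup>2"
        using w by (intro divide_left_mono power_mono mult_pos_pos) auto
      finally show "cmod (deriv u w) \<le> 80/63" by (simp add: power2_eq_square)
    qed auto
    also have "\<dots> \<le> (cmod (f w))\<^sup>2 * 6"
      by (intro mult_left_mono) (auto simp: power2_eq_square)
    finally show ?thesis by (simp add: mult.commute)
  qed
qed

section \<open>Inverse branches of polynomials and the Newton map\<close>

text \<open>With no critical value in the disk, every fibre over it has exactly
  \<open>degree P\<close> points. Small disjoint neighbourhoods of the points of one fibre are the
  sheets, and counting shows that they exhaust the preimage of a small set.\<close>

lemma poly_covering_space: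
  fixes P :: "complex poly"
  assumes deg: "degree P > 0" and R: "\<And>c. c \<in> Crit P \<Longrightarrow> R \<le> cmod (poly P c)"
  shows "covering_space {z. cmod (poly P z) < R} (poly P) (ball 0 R)"
proof -
  define n where "n = degree P"
  have fib_le: "finite {z. poly P z = q}" "card {z. poly P z = q} \<le> n" for q
  proof -
    define p where "p = P + [:- q:]"
    have dp: "degree p = n" unfolding p_def n_def using deg by (intro degree_add_eq_left) simp
    then have "p \<noteq> 0" using deg n_def by auto
    moreover have "{z. poly P z = q} = {z. poly p z = 0}" by (auto simp: p_def)
    ultimately show "finite {z. poly P z = q}" "card {z. poly P z = q} \<le> n"
      using poly_roots_finite card_poly_roots_bound dp by metis+
  qed
  have fib_eq: "card {z. poly P z = q} = n" if "cmod q < R" for q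
  proof -
    define p where "p = P + [:- q:]"
    have dp: "degree p = n" unfolding p_def n_def using deg by (intro degree_add_eq_left) simp
    then have "p \<noteq> 0" using deg n_def by auto
    have Z: "{z. poly P z = q} = {z. poly p z = 0}" by (auto simp: p_def)
    \<comment> \<open>A multiple root of P - q would be a critical point whose value q has modulus
      below \<open>R\<close>.\<close>
    have "poly (pderiv p) z \<noteq> 0" if "poly p z = 0" for z
      using R[of z] that \<open>cmod q < R\<close> by (auto simp: p_def Crit_def pderiv_add pderiv_pCons)
    then have "rsquarefree p" by (auto simp: rsquarefree_roots)
    then have "n = degree (\<Prod>z|poly p z = 0. [:- z, 1:])"
      using complex_poly_decompose_rsquarefree[of p] \<open>p \<noteq> 0\<close> dp
      by (metis degree_smult_eq leading_coeff_0_iff)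
    also have "\<dots> = (\<Sum>z|poly p z = 0. degree [:- z, 1:])"
      by (rule degree_prod_sum_eq) auto
    finally show ?thesis using Z by simp
  qed
  have contP: "continuous_on A (poly P)" for A
    by (intro continuous_intros)
  have holP: "poly P holomorphic_on A" for A
    by (meson poly_DERIV field_differentiable_def field_differentiable_at_within holomorphic_on_def)
  show ?thesis
  proof
    show "continuous_on {z. cmod (poly P z) < R} (poly P)" by (rule contP)
    show "poly P ` {z. cmod (poly P z) < R} = ball 0 R"
    proof -
      have "\<exists>z. poly P z = q" if "cmod q < R" for q
        using fib_eq[OF that] deg n_def by (metis (mono_tags) Collect_empty_eq card.empty not_gr0)
      then show ?thesis by force
    qed
  next
    fix x :: complex assume "x \<in> ball 0 R"
    then have xR: "cmod x < R" by simp
    define Z where "Z = {z. poly P z = x}"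
    have "finite Z" and cardZ: "card Z = n" using fib_le(1) fib_eq[OF xR] by (auto simp: Z_def)
    \<comment> \<open>Half the distance to the rest of the fibre makes the balls pairwise
      disjoint.\<close>
    have "\<exists>e. e > 0 \<and> inj_on (poly P) (ball z e) \<and> (\<forall>y\<in>Z. y \<noteq> z \<longrightarrow> 2 * e \<le> dist z y)" if "z \<in> Z" for z
    proof -
      have "deriv (poly P) z \<noteq> 0"
        using R[of z] that xR by (auto simp: Z_def Crit_def DERIV_imp_deriv[OF poly_DERIV])
      then obtain r where r: "r > 0" "inj_on (poly P) (ball z r)"
        using has_complex_derivative_locally_injective[of "poly P" UNIV z] holP by auto
      obtain d where d: "d > 0" "\<forall>y\<in>Z. y \<noteq> z \<longrightarrow> d \<le> dist z y"
        using finite_set_avoid[OF \<open>finite Z\<close>, of z] by auto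
      show ?thesis
        by (rule exI[of _ "min r (d / 2)"]) (use r d in \<open>auto intro: inj_on_subset\<close>)
    qed
    then obtain e where e: "\<And>z. z \<in> Z \<Longrightarrow> e z > 0" "\<And>z. z \<in> Z \<Longrightarrow> inj_on (poly P) (ball z (e z))"
        "\<And>z y. z \<in> Z \<Longrightarrow> y \<in> Z \<Longrightarrow> y \<noteq> z \<Longrightarrow> 2 * e z \<le> dist z y"
      by metis
    define U where "U z = ball z (e z)" for z
    have disj: "z = y" if "z \<in> Z" "y \<in> Z" "a \<in> U z" "a \<in> U y" for z y a
    proof (rule ccontr)
      assume "z \<noteq> y"
      then have "2 * e z \<le> dist z y" "2 * e y \<le> dist z y"
        using e(3)[of z y] e(3)[of y z] that by (auto simp: dist_commute)
      moreover have "dist z y < e z + e y"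
        using that dist_triangle2[of z y a] by (auto simp: U_def dist_commute)
      ultimately show False by simp
    qed
    define T where "T = ball 0 R \<inter> (\<Inter>z\<in>Z. poly P ` U z)"
    have "open (poly P ` U z)" if "z \<in> Z" for z
      using open_mapping_thm3[of "poly P" "U z"] e(2)[OF that] holP by (auto simp: U_def)
    then have "open T"
      unfolding T_def using \<open>finite Z\<close> by (intro open_Int open_INT) auto
    have "x \<in> T"
      using xR e(1) by (force simp: T_def Z_def U_def)
    \<comment> \<open>A value in \<open>T\<close> is taken once in each of the n disjoint sheets.
      The fibre has at most n points, so none lies outside the sheets.\<close>
    have covered: "\<exists>z\<in>Z. y \<in> U z" if "poly P y \<in> T" for y
    proof -
      have "\<exists>a. a \<in> U z \<and> poly P a = poly P y" if "z \<in> Z" for z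
        using \<open>poly P y \<in> T\<close> that unfolding T_def by fastforce
      then obtain g where g: "\<And>z. z \<in> Z \<Longrightarrow> g z \<in> U z" "\<And>z. z \<in> Z \<Longrightarrow> poly P (g z) = poly P y"
        by metis
      have "inj_on g Z"
        using g(1) disj by (metis inj_onI)
      then have "card (g ` Z) = n" using cardZ by (simp add: card_image)
      then have "g ` Z = {a. poly P a = poly P y}"
        using fib_le[of "poly P y"] g(2) by (intro card_seteq) auto
      then have "y \<in> g ` Z" by simp
      then show ?thesis using g(1) by auto
    qed
    have opn: "open (U z \<inter> poly P -` T)" for z
      using \<open>open T\<close> by (intro open_Int open_vimage contP) (auto simp: U_def)
    show "\<exists>T. x \<in> T \<and> openin (top_of_set (ball 0 R)) T \<and>
          (\<exists>v. \<Union>v = {z. cmod (poly P z) < R} \<inter> poly P -` T \<and>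
               (\<forall>u\<in>v. openin (top_of_set {z. cmod (poly P z) < R}) u) \<and>
               pairwise disjnt v \<and> (\<forall>u\<in>v. \<exists>q. homeomorphism u T (poly P) q))"
    proof (intro exI[of _ T] conjI exI[of _ "(\<lambda>z. U z \<inter> poly P -` T) ` Z"] ballI)
      show "openin (top_of_set (ball 0 R)) T"
        using \<open>open T\<close> by (intro open_subset) (auto simp: T_def)
      show "\<Union> ((\<lambda>z. U z \<inter> poly P -` T) ` Z) = {z. cmod (poly P z) < R} \<inter> poly P -` T"
        using covered by (auto simp: T_def)
      show "pairwise disjnt ((\<lambda>z. U z \<inter> poly P -` T) ` Z)"
        using disj by (fastforce simp: pairwise_def disjnt_def)
      fix u assume "u \<in> (\<lambda>z. U z \<inter> poly P -` T) ` Z"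
      then obtain z where z: "z \<in> Z" and u: "u = U z \<inter> poly P -` T" by auto
      show "openin (top_of_set {z. cmod (poly P z) < R}) u"
        unfolding u by (intro open_subset opn) (auto simp: T_def)
      have "T \<subseteq> poly P ` U z" using z by (auto simp: T_def)
      then have "poly P ` u = T" unfolding u by blast
      moreover have "inj_on (poly P) u"
        using e(2)[OF z] by (auto simp: u U_def intro: inj_on_subset)
      then obtain q where "homeomorphism u (poly P ` u) (poly P) q"
        using invariance_of_domain_homeomorphism[of u "poly P"] opn u contP by blast
      ultimately show "\<exists>q. homeomorphism u T (poly P) q" by auto
    qed fact
  qed
qed

text \<open>The disk is simply connected, so its identity map lifts through the covering with
  prescribed value \<open>a\<close>. The lift is continuous and avoids critical points, hence is
  holomorphic with derivative 1/P'.\<close>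

lemma poly_inverse_branch:
  fixes P :: "complex poly"
  assumes deg: "degree P > 0" and R: "\<And>c. c \<in> Crit P \<Longrightarrow> R \<le> cmod (poly P c)" and a: "cmod (poly P a) < R"
  obtains \<phi> :: "complex \<Rightarrow> complex" where "\<phi> (poly P a) = a" "\<And>w. w \<in> ball 0 R \<Longrightarrow> poly P (\<phi> w) = w"
    "\<And>w. w \<in> ball 0 R \<Longrightarrow> \<phi> w \<notin> Crit P"
    "\<And>w. w \<in> ball 0 R \<Longrightarrow> (\<phi> has_field_derivative inverse (poly (pderiv P) (\<phi> w))) (at w)"
proof -
  obtain \<phi> :: "complex \<Rightarrow> complex" where \<phi>: "continuous_on (ball 0 R) \<phi>" "\<phi> \<in> ball 0 R \<rightarrow> {z. cmod (poly P z) < R}"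
    "\<phi> (poly P a) = a" "\<And>w. w \<in> ball 0 R \<Longrightarrow> poly P (\<phi> w) = w"
  proof (rule covering_space_lift_strong[OF poly_covering_space[OF deg R], where f = "\<lambda>w. w" and U = "ball 0 R" and a = a and z = "poly P a"])
    show "simply_connected (ball (0::complex) R)"
      by (simp add: convex_imp_simply_connected)
    show "locally path_connected (ball (0::complex) R)"
      by (simp add: convex_imp_locally_path_connected)
  qed (use a in auto)
  have crit: "\<phi> w \<notin> Crit P" if "w \<in> ball 0 R" for w
    using R[of "\<phi> w"] \<phi>(4)[OF that] that by auto
  have "(\<phi> has_field_derivative inverse (poly (pderiv P) (\<phi> w))) (at w)" if "w \<in> ball 0 R" for w
  proof (rule has_field_derivative_inverse_basic)
    show "(poly P has_field_derivative poly (pderiv P) (\<phi> w)) (at (\<phi> w))" by (rule poly_DERIV)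
    show "poly (pderiv P) (\<phi> w) \<noteq> 0" using crit[OF that] by (simp add: Crit_def)
    show "continuous (at w) \<phi>" using \<phi>(1) that by (simp add: continuous_on_eq_continuous_at)
    show "open (ball (0::complex) R)" by simp
  qed (use that \<phi>(4) in auto)
  with \<phi> crit show thesis using that by blast
qed

text \<open>The branch through \<open>a\<close> sends 0 to a root \<open>r\<close>; \<open>f\<close>
  is this branch rescaled to unit disk and unit derivative. Since it inverts \<open>P\<close>, the
  Newton step P/P' becomes w f'(w) up to the factor R/P'(r).\<close>

lemma normalized_inverse_branch:
  fixes P :: "complex poly"
  assumes deg: "degree P > 0" and R: "\<And>c. c \<in> Crit P \<Longrightarrow> R \<le> cmod (poly P c)" and a: "cmod (poly P a) < R"
  obtains r f where "poly P r = 0" "f holomorphic_on ball 0 1" "inj_on f (ball 0 1)" "f 0 = 0" "deriv f 0 = 1"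
    "\<And>w. w \<in> ball 0 1 \<Longrightarrow> r + R / poly (pderiv P) r * f w \<notin> Crit P"
    "\<And>w. w \<in> ball 0 1 \<Longrightarrow> poly P (r + R / poly (pderiv P) r * f w) = R * w"
    "\<And>w. w \<in> ball 0 1 \<Longrightarrow> newton_map P (r + R / poly (pderiv P) r * f w) - r
        = R / poly (pderiv P) r * (f w - w * deriv f w)"
    "r + R / poly (pderiv P) r * f (poly P a / R) = a"
proof -
  have Rpos: "R > 0" using a norm_ge_zero[of "poly P a"] by linarith
  obtain \<phi> :: "complex \<Rightarrow> complex" where \<phi>: "\<phi> (poly P a) = a" "\<And>w. w \<in> ball 0 R \<Longrightarrow> poly P (\<phi> w) = w"
    "\<And>w. w \<in> ball 0 R \<Longrightarrow> \<phi> w \<notin> Crit P"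
    "\<And>w. w \<in> ball 0 R \<Longrightarrow> (\<phi> has_field_derivative inverse (poly (pderiv P) (\<phi> w))) (at w)"
    using poly_inverse_branch[OF assms] by metis
  define r where "r = \<phi> 0"
  define D where "D = poly (pderiv P) r"
  define f where "f w = D / R * (\<phi> (R * w) - r)" for w :: complex
  have Dnz: "D \<noteq> 0" using \<phi>(3)[of 0] Rpos by (simp add: D_def r_def Crit_def)
  have scale: "R * w \<in> ball 0 R" if "w \<in> ball 0 1" for w :: complex
    using that Rpos by (simp add: norm_mult)
  have unscale: "r + R / D * f w = \<phi> (R * w)" for w :: complex
    using Dnz Rpos by (simp add: f_def)
  have df: "(f has_field_derivative D / poly (pderiv P) (\<phi> (R * w))) (at w)" if "w \<in> ball 0 1" for w :: complex
  proof -
    have "((\<lambda>w. of_real R * w) has_field_derivative of_real R) (at w)"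
      by (auto intro!: derivative_eq_intros)
    with \<phi>(4)[OF scale[OF that]]
    have "((\<lambda>w. \<phi> (R * w)) has_field_derivative inverse (poly (pderiv P) (\<phi> (R * w))) * R) (at w)"
      by (rule DERIV_chain2[where g = "\<lambda>w. of_real R * w"])
    then have "(f has_field_derivative D / R * (inverse (poly (pderiv P) (\<phi> (R * w))) * R - 0)) (at w)"
      unfolding f_def by (intro DERIV_cmult DERIV_diff DERIV_const)
    then show ?thesis using Rpos by (simp add: field_simps)
  qed
  have "f holomorphic_on ball 0 1"
    unfolding holomorphic_on_open[OF open_ball] using df by blast
  moreover have "inj_on f (ball 0 1)"
  proof (rule inj_onI)
    fix w w' :: complex assume w: "w \<in> ball 0 1" "w' \<in> ball 0 1" "f w = f w'"
    then have "\<phi> (R * w) = \<phi> (R * w')" using unscale by metis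
    then have "R * w = R * w'" using \<phi>(2) scale w by metis
    then show "w = w'" using Rpos by simp
  qed
  moreover have "f 0 = 0" by (simp add: f_def r_def)
  moreover have "deriv f 0 = 1"
    using DERIV_imp_deriv[OF df[of 0]] Dnz by (simp add: D_def r_def)
  moreover have "newton_map P (r + R / D * f w) - r = R / D * (f w - w * deriv f w)" if w: "w \<in> ball 0 1" for w
  proof -
    have "newton_map P (r + R / D * f w) - r = R / D * f w - R * w / poly (pderiv P) (\<phi> (R * w))"
      using \<phi>(2)[OF scale[OF w]] by (simp add: newton_map_def flip: unscale)
    also have "deriv f w = D / poly (pderiv P) (\<phi> (R * w))"
      using df[OF w] by (rule DERIV_imp_deriv)
    then have "R * w / poly (pderiv P) (\<phi> (R * w)) = R / D * (w * deriv f w)"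
      using Dnz by simp
    finally show ?thesis by (simp add: right_diff_distrib)
  qed
  moreover have "poly P r = 0" using \<phi>(2)[of 0] Rpos by (simp add: r_def)
  moreover have "r + R / D * f (poly P a / R) = a"
    using Rpos unscale[of "poly P a / R"] \<phi>(1) by simp
  moreover have "r + R / D * f w \<notin> Crit P" "poly P (r + R / D * f w) = R * w" if "w \<in> ball 0 1" for w :: complex
    unfolding unscale by (fact \<phi>(3)[OF scale[OF that]] \<phi>(2)[OF scale[OF that]])+
  ultimately show thesis
    using that[of r f] unfolding D_def by blast
qed

section \<open>Newton map and Newton flow near the roots\<close>

text \<open>On the branch through \<open>r\<close> itself, the disk of radius d/8 with d = R/|P'(r)|
  corresponds to f-values of modulus below 1/8. These are attained for |w| < 1/4, where the
  quadratic estimate applies.\<close>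

lemma newton_map_quadratic:
  fixes P :: "complex poly"
  assumes deg: "degree P > 0" and R: "\<And>c. c \<in> Crit P \<Longrightarrow> R \<le> cmod (poly P c)" and Rpos: "R > 0"
    and r: "poly P r = 0" and z: "cmod (z - r) < R / cmod (poly (pderiv P) r) / 8"
  shows "z \<notin> Crit P" and "cmod (newton_map P z - r) \<le> 6 / (R / cmod (poly (pderiv P) r)) * (cmod (z - r))\<^sup>2"
proof -
  define D where "D = poly (pderiv P) r"
  have "cmod (poly P r) < R" using r Rpos by simp
  then obtain r' f where f: "f holomorphic_on ball 0 1" "inj_on f (ball 0 1)" "f 0 = 0" "deriv f 0 = 1"
    and crit: "\<And>w. w \<in> ball 0 1 \<Longrightarrow> r' + R / poly (pderiv P) r' * f w \<notin> Crit P"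
    and newton: "\<And>w. w \<in> ball 0 1 \<Longrightarrow> newton_map P (r' + R / poly (pderiv P) r' * f w) - r'
        = R / poly (pderiv P) r' * (f w - w * deriv f w)"
    and r': "r' + R / poly (pderiv P) r' * f (poly P r / R) = r"
    using normalized_inverse_branch[OF deg R, of r] by metis
  \<comment> \<open>The parameter P(r)/R is 0, and f(0) = 0.\<close>
  have [simp]: "r' = r" using r' r f(3) by simp
  have Dnz: "D \<noteq> 0" using R[of r] Rpos r by (auto simp: D_def Crit_def)
  have norm_w: "cmod (D / R * (z - r)) = cmod D / R * cmod (z - r)"
    using Rpos by (simp add: norm_mult norm_divide)
  also have "\<dots> < 1/8"
    using z Rpos Dnz by (simp add: D_def field_simps)
  finally have "D / R * (z - r) \<in> ball 0 (1/8)" by simp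
  then obtain w where w: "cmod w < 1/4" "f w = D / R * (z - r)"
    using univalent_bounds(1)[OF f] by auto
  have wb: "w \<in> ball 0 1" using w(1) by simp
  have zw: "r + R / D * f w = z" using w(2) Dnz Rpos by simp
  show "z \<notin> Crit P" using crit[OF wb] zw by (simp add: D_def)
  have "cmod (newton_map P z - r) = R / cmod D * cmod (f w - w * deriv f w)"
    using newton[OF wb] zw Rpos by (simp add: D_def norm_mult norm_divide)
  also have "\<dots> \<le> R / cmod D * (6 * (cmod (f w))\<^sup>2)"
    using univalent_bounds(3)[OF f, of w] w(1) Rpos by (intro mult_left_mono) auto
  also have "\<dots> = 6 / (R / cmod D) * (cmod (z - r))\<^sup>2"
    unfolding w(2) norm_w using Rpos Dnz by (simp add: power2_eq_square field_simps)
  finally show "cmod (newton_map P z - r) \<le> 6 / (R / cmod (poly (pderiv P) r)) * (cmod (z - r))\<^sup>2"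
    by (simp add: D_def)
qed

text \<open>The root is the value at 0 of the inverse branch through \<open>a\<close>. The parameter
  P(a)/R has modulus at most 23/250, where |f| < 1/8.\<close>

lemma small_value_near_root:
  fixes P :: "complex poly"
  assumes deg: "degree P > 0" and R: "\<And>c. c \<in> Crit P \<Longrightarrow> R \<le> cmod (poly P c)" and Rpos: "R > 0"
    and a: "cmod (poly P a) \<le> 23/250 * R"
  obtains r where "poly P r = 0" "cmod (a - r) < R / cmod (poly (pderiv P) r) / 8"
proof -
  have "cmod (poly P a) < R" using a Rpos by simp
  then obtain r f where r: "poly P r = 0" and f: "f holomorphic_on ball 0 1" "inj_on f (ball 0 1)" "f 0 = 0" "deriv f 0 = 1"
    and ra: "r + R / poly (pderiv P) r * f (poly P a / R) = a"
    using normalized_inverse_branch[OF deg R, of a] by metis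
  have Dnz: "poly (pderiv P) r \<noteq> 0" using R[of r] Rpos r by (auto simp: Crit_def)
  have ar: "a - r = R / poly (pderiv P) r * f (poly P a / R)"
    using ra by (metis add_diff_cancel_left')
  have "cmod (a - r) = R / cmod (poly (pderiv P) r) * cmod (f (poly P a / R))"
    unfolding ar using Rpos by (simp add: norm_mult norm_divide)
  also have "cmod (poly P a / R) \<le> 23/250"
    using a Rpos by (simp add: norm_divide field_simps)
  then have "cmod (f (poly P a / R)) < 1/8" by (rule univalent_bounds(2)[OF f])
  then have "R / cmod (poly (pderiv P) r) * cmod (f (poly P a / R)) < R / cmod (poly (pderiv P) r) * (1/8)"
    using Rpos Dnz by (intro mult_strict_left_mono) auto
  finally show thesis using that[OF r] by simp
qed

text \<open>The scaled error 6|z - r|/d is at most squared by each step and starts below 6/8 = 3/4.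
  Its bound (3/4)^(2^n) also keeps the orbit in the disk, away from critical points.\<close>

lemma quadratic_contraction_converges:
  assumes d: "d > 0"
    and crit: "\<And>z. cmod (z - r) < d / 8 \<Longrightarrow> z \<notin> Crit P"
    and step: "\<And>z. cmod (z - r) < d / 8 \<Longrightarrow> cmod (newton_map P z - r) \<le> 6 / d * (cmod (z - r))\<^sup>2"
    and z: "cmod (z - r) < d / 8"
  shows "newton_converges_biexp P r z"
proof -
  have bound: "6 / d * cmod ((newton_map P ^^ n) z - r) < (3/4) ^ (2 ^ n)" for n
  proof (induction n)
    case 0
    then show ?case using z d by (simp add: field_simps)
  next
    case (Suc n)
    define e where "e = cmod ((newton_map P ^^ n) z - r)"
    have IH: "6 / d * e < (3/4) ^ (2 ^ n)" using Suc by (simp add: e_def)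
    also have "\<dots> \<le> (3/4 :: real) ^ 1" by (intro power_decreasing) auto
    finally have "e < d / 8" using d by (simp add: field_simps)
    then have "cmod ((newton_map P ^^ Suc n) z - r) \<le> 6 / d * e\<^sup>2"
      using step by (simp add: e_def)
    then have "6 / d * cmod ((newton_map P ^^ Suc n) z - r) \<le> 6 / d * (6 / d * e\<^sup>2)"
      using d by (intro mult_left_mono) auto
    also have "\<dots> = (6 / d * e)\<^sup>2" by (simp add: power2_eq_square)
    also have "\<dots> < ((3/4) ^ (2 ^ n))\<^sup>2"
      using IH d by (intro power_strict_mono) (auto simp: e_def)
    finally show ?case by (simp add: power_mult[symmetric] mult.commute)
  qed
  have "cmod ((newton_map P ^^ n) z - r) < d / 8" for n
  proof -
    have "6 / d * cmod ((newton_map P ^^ n) z - r) < (3/4 :: real) ^ 1"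
      using bound[of n] by (rule less_le_trans) (intro power_decreasing, auto)
    then show ?thesis using d by (simp add: field_simps)
  qed
  moreover have "cmod ((newton_map P ^^ n) z - r) \<le> inverse (6 / d) * (3/4) ^ (2 ^ n)" for n
    using bound[of n] d by (simp add: field_simps)
  ultimately show ?thesis
    unfolding newton_converges_biexp_def using crit d
    by (intro conjI allI exI[of _ "6 / d"] exI[of _ "3/4"]) auto
qed

text \<open>Along the flow the derivative of P(\<zeta>(t)) is -P(\<zeta>(t)), so e^t P(\<zeta>(t))
  is constant.\<close>

lemma newton_flow_decay:
  assumes flow: "newton_flow_solution P T \<zeta>" and T: "T \<ge> 0"
  shows "poly P (\<zeta> T) = exp (- T) * poly P (\<zeta> 0)"
proof -
  have zero: "((\<lambda>t. exp (of_real t) * poly P (\<zeta> t)) has_vector_derivative 0) (at t within {0..T})" if t: "t \<in> {0..T}" for t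
  proof -
    have nz: "poly (pderiv P) (\<zeta> t) \<noteq> 0"
      and d: "(\<zeta> has_vector_derivative - (poly P (\<zeta> t) / poly (pderiv P) (\<zeta> t))) (at t within {0..T})"
      using flow t by (auto simp: newton_flow_solution_def Crit_def)
    have 1: "((\<lambda>t. poly P (\<zeta> t)) has_vector_derivative - poly P (\<zeta> t)) (at t within {0..T})"
      using field_vector_diff_chain_within[OF d, of "poly P" "poly (pderiv P) (\<zeta> t)"] nz
      by (simp add: o_def has_field_derivative_at_within[OF poly_DERIV])
    have 2: "((\<lambda>t. exp (of_real t)) has_vector_derivative exp (of_real t :: complex)) (at t within {0..T})"
      by (rule has_vector_derivative_real_field[OF DERIV_exp])
    show ?thesis
      using has_vector_derivative_mult[OF 2 1] by simp
  qed
  obtain c where c: "\<And>t. t \<in> {0..T} \<Longrightarrow> exp (of_real t) * poly P (\<zeta> t) = c"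
  proof (rule has_vector_derivative_zero_constant[OF convex_real_interval(5)])
    show "((\<lambda>t. exp (of_real t) * poly P (\<zeta> t)) has_vector_derivative 0) (at t within {0..T})"
      if "t \<in> {0..T}" for t by (rule zero[OF that])
  qed (rule that)
  have "exp (of_real T) * poly P (\<zeta> T) = poly P (\<zeta> 0)"
    using c[of T] c[of 0] T by simp
  then show ?thesis by (simp add: exp_minus field_simps)
qed

section \<open>Critical values and the choice of constants\<close>

lemma Crit_values:
  assumes deg: "degree P \<ge> 2" and sq: "rsquarefree P"
  shows "\<And>c. c \<in> Crit P \<Longrightarrow> min_crit_value P \<le> cmod (poly P c)"
    and "min_crit_value P > 0" and "min_crit_value P \<le> max_crit_value P"
proof -
  have dp: "degree (pderiv P) = degree P - 1" by (rule degree_pderiv)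
  then have "pderiv P \<noteq> 0" using deg by auto
  then have fin: "finite ((\<lambda>c. cmod (poly P c)) ` Crit P)"
    unfolding Crit_def by (intro finite_imageI poly_roots_finite)
  have "\<not> constant (poly (pderiv P))" using dp deg by (simp add: constant_degree)
  then have ne: "(\<lambda>c. cmod (poly P c)) ` Crit P \<noteq> {}"
    using fundamental_theorem_of_algebra by (auto simp: Crit_def)
  show "min_crit_value P \<le> cmod (poly P c)" if "c \<in> Crit P" for c
    unfolding min_crit_value_def using fin that by (intro Min_le) auto
  \<comment> \<open>Simple roots mean that no critical value vanishes.\<close>
  show "min_crit_value P > 0"
    unfolding min_crit_value_def using fin ne sq by (auto simp: Crit_def rsquarefree_roots)
  show "min_crit_value P \<le> max_crit_value P"
    unfolding min_crit_value_def max_crit_value_def using fin ne by (meson Max_ge Min_in Min_le Max_in)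
qed

theorem theorem5:
  "\<exists>\<rho>\<^sub>2 \<beta>\<^sub>2 :: real.
     approx6 \<rho>\<^sub>2 0.110549 \<and> approx6 \<beta>\<^sub>2 0.091287 \<and>
     (\<forall>P :: complex poly. degree P \<ge> 2 \<longrightarrow> rsquarefree P \<longrightarrow>
        (\<forall>r. poly P r = 0 \<longrightarrow>
           (\<forall>z \<in> ball r (\<rho>\<^sub>2 * min_crit_value P / cmod (poly (pderiv P) r)).
              newton_converges_biexp P r z)) \<and>
        (\<forall>\<zeta> :: real \<Rightarrow> complex.
           newton_flow_solution P (flow_time \<beta>\<^sub>2 P) \<zeta> \<longrightarrow> \<zeta> 0 \<in> level_line P \<longrightarrow>
           (\<exists>r. poly P r = 0 \<and> \<zeta> (flow_time \<beta>\<^sub>2 P) \<in> quadratic_basin P r))) \<and>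
     ln (1.1 / \<beta>\<^sub>2) \<le> 2.5"
proof -
  \<comment> \<open>The displayed decimals themselves serve as constants: the estimates hold up to
    1/8 > \<rho> and 23/250 > \<beta>.\<close>
  define \<rho> \<beta> :: real where "\<rho> = 0.110549" and "\<beta> = 0.091287"
  have newton: "newton_converges_biexp P r z"
    if deg: "degree P \<ge> 2" and sq: "rsquarefree P" and r: "poly P r = 0"
      and z: "cmod (z - r) < min_crit_value P / cmod (poly (pderiv P) r) / 8" for P r z
  proof (rule quadratic_contraction_converges)
    have "poly (pderiv P) r \<noteq> 0" using sq r by (auto simp: rsquarefree_roots)
    then show "min_crit_value P / cmod (poly (pderiv P) r) > 0"
      using Crit_values(2)[OF deg sq] by simp
  qed (use newton_map_quadratic[OF _ Crit_values(1,2)[OF deg sq] r] deg z in auto)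
  have "ln (1.1 / \<beta>) \<le> 2.5"
  proof -
    \<comment> \<open>Writing e^2.5 as (e^0.1)^25 makes the quadratic Taylor bound sharp enough:
      1.105^25 is about 12.13, while 1.1/\<beta> is about 12.05.\<close>
    have "(1 + 1/10 + (1/10)\<^sup>2 / 2) ^ 25 \<le> exp (1/10 :: real) ^ 25"
      by (intro power_mono exp_lower_Taylor_quadratic) auto
    also have "\<dots> = exp (2.5 :: real)" by (simp flip: exp_of_nat_mult)
    finally have "1.1 / \<beta> \<le> exp 2.5"
      by (rule order_trans[rotated]) (simp add: \<beta>_def power2_eq_square power_divide)
    then have "ln (1.1 / \<beta>) \<le> ln (exp 2.5)"
      by (subst ln_le_cancel_iff) (auto simp: \<beta>_def)
    then show ?thesis by simp
  qed
  moreover have "newton_converges_biexp P r z"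
    if P: "degree P \<ge> 2" "rsquarefree P" "poly P r = 0"
      and z: "z \<in> ball r (\<rho> * min_crit_value P / cmod (poly (pderiv P) r))" for P r z
  proof (rule newton[OF P])
    have "cmod (z - r) < \<rho> * (min_crit_value P / cmod (poly (pderiv P) r))"
      using z by (simp add: dist_norm norm_minus_commute)
    also have "\<dots> \<le> 1/8 * (min_crit_value P / cmod (poly (pderiv P) r))"
      using Crit_values(2)[OF P(1,2)] by (intro mult_right_mono) (auto simp: \<rho>_def)
    finally show "cmod (z - r) < min_crit_value P / cmod (poly (pderiv P) r) / 8" by simp
  qed
  moreover have "\<exists>r. poly P r = 0 \<and> \<zeta> (flow_time \<beta> P) \<in> quadratic_basin P r"
    if deg: "degree P \<ge> 2" and sq: "rsquarefree P" and flow: "newton_flow_solution P (flow_time \<beta> P) \<zeta>"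
      and start: "\<zeta> 0 \<in> level_line P" for P \<zeta>
  proof -
    define T where "T = flow_time \<beta> P"
    define m M where "m = min_crit_value P" and "M = max_crit_value P"
    have mM: "0 < m" "m \<le> M" using Crit_values(2,3)[OF deg sq] by (auto simp: m_def M_def)
    have "T = ln (1.1 / \<beta>) + ln (M / m)"
      by (simp only: T_def flow_time_def m_def M_def)
    also have "\<dots> = ln (1.1 / \<beta> * (M / m))"
      using mM by (intro ln_mult_pos[symmetric]) (auto simp: \<beta>_def)
    finally have T: "T = ln (1.1 / \<beta> * (M / m))" .
    have "1 * 1 \<le> 1.1 / \<beta> * (M / m)"
      using mM by (intro mult_mono) (auto simp: \<beta>_def)
    then have "T \<ge> 0" unfolding T by simp
    have "exp (- T) = \<beta> / 1.1 * (m / M)"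
      using mM by (simp add: T exp_minus \<beta>_def field_simps)
    moreover have "cmod (poly P (\<zeta> T)) = exp (- T) * cmod (poly P (\<zeta> 0))"
      using newton_flow_decay[OF flow[folded T_def] \<open>T \<ge> 0\<close>] by (simp add: norm_mult norm_exp_eq_Re)
    moreover have "cmod (poly P (\<zeta> 0)) = 1.1 * M"
      using start by (simp add: level_line_def M_def)
    \<comment> \<open>The decay factor cancels the starting level, so the flow ends at |P| = \<beta>
      m.\<close>
    ultimately have "cmod (poly P (\<zeta> T)) = \<beta> / 1.1 * (m / M) * (1.1 * M)" by (simp only:)
    also have "\<dots> \<le> 23/250 * m" using mM by (simp add: \<beta>_def)
    finally obtain r where "poly P r = 0" "cmod (\<zeta> T - r) < m / cmod (poly (pderiv P) r) / 8"
      using small_value_near_root[OF _ Crit_values(1,2)[OF deg sq]] deg unfolding m_def by auto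
    then show ?thesis
      using newton[OF deg sq] unfolding T_def m_def quadratic_basin_def by blast
  qed
  moreover have "approx6 \<rho> 0.110549" "approx6 \<beta> 0.091287"
    by (simp_all add: approx6_def \<rho>_def \<beta>_def)
  ultimately show ?thesis by blast
qed

end
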